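(* Let $k>2$, and let $\mathcal D$ be a distribution over $\mathbb R^d$ with mean $\mu$ and $k$-th moment bounded by $1$. There exists a person-level $(\epsilon,\delta)$-DP clip-and-noise based algorithm that takes as input a coarse estimate $\mu_{\mathrm{coarse}}$ with $\|\mu_{\mathrm{coarse}}-\mu\|_2\le O(\sqrt{d/m})$, together with \[ n=\tilde O_k\left(\frac{d}{m\alpha^2}+\frac{d\sqrt{\log(1/\delta)}}{\alpha\sqrt m\epsilon}+\frac{d^{(2k-1)/(2k-2)}\sqrt{\log(1/\delta)}}{\alpha^{k/(k-1)}m\epsilon}\right) \] people, each having $m$ i.i.d. samples from $\mathcal D$, and outputs $\hat\mu$ with $\|\hat\mu-\mu\|_2\le\alpha$ with success probability $2/3$.
   Context: $k$-th moment bounded by $1$: $\sup_{\|v\|_2=1}\mathbb E_{Y\sim\mathcal D}[|\langle Y-\mu,v\rangle|^k]\le1$. Person-level $(\epsilon,\delta)$-DP: neighboring datasets differ in all $m$ samples of at most one person, and $\Pr[A(X)\in Y]\le e^\epsilon\Pr[A(X')\in Y]+\delta$ for all neighbors and output sets. A clip-and-noise algorithm averages each person's samples, projects each average onto an $\ell_2$ ball of radius $\rho$ around the coarse estimate, averages the projected values and adds Gaussian noise. $\tilde O_k$ hides factors depending only on $k$ and polylogarithmic factors.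
   Formalization: The formal theorem assumes 0<δ<1 and ε ≤ K·log(1/δ) for an arbitrary constant K, on which the hidden constant may depend; without it the stated Gaussian noise scale √log(1/δ)/ε is too small (e.g. fixed δ, ε→∞). *)

theory Defs
  imports "HOL-Probability.Probability"
begin

text \<open>
  The hidden constants in the sample complexity must not depend on the dimension \<open>d\<close>, so \<open>d\<close> has to be
  quantified inside the statement. Vectors of \<open>\<real>\<^sup>d\<close> are therefore functions \<open>nat \<Rightarrow> real\<close>
  that are extensional on \<open>{..<d}\<close>, with the product Borel structure.
\<close>

type_synonym vec = "nat \<Rightarrow> real"

definition Rd :: "nat \<Rightarrow> vec measure" where
  "Rd d = Pi\<^sub>M {..<d} (\<lambda>_. borel)"

definition l2_norm :: "nat \<Rightarrow> vec \<Rightarrow> real" where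
  "l2_norm d v = L2_set v {..<d}"

definition l2_dist :: "nat \<Rightarrow> vec \<Rightarrow> vec \<Rightarrow> real" where
  "l2_dist d x y = l2_norm d (\<lambda>i. x i - y i)"

definition has_mean :: "nat \<Rightarrow> vec measure \<Rightarrow> vec \<Rightarrow> bool" where
  "has_mean d D \<mu> \<longleftrightarrow> \<mu> \<in> space (Rd d) \<and>
     (\<forall>i<d. integrable D (\<lambda>y. y i) \<and> integral\<^sup>L D (\<lambda>y. y i) = \<mu> i)"

text \<open>The moments are taken in \<open>[0, \<infinity>]\<close>, so that the bound includes their finiteness.\<close>

definition moment_bounded :: "nat \<Rightarrow> real \<Rightarrow> vec measure \<Rightarrow> vec \<Rightarrow> bool" where
  "moment_bounded d k D \<mu> \<longleftrightarrow>
     (SUP v \<in> {v \<in> space (Rd d). l2_norm d v = 1}.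
        \<integral>\<^sup>+ y. ennreal (\<bar>\<Sum>i<d. (y i - \<mu> i) * v i\<bar> powr k) \<partial>D) \<le> 1"

text \<open>A dataset \<open>X\<close> of \<open>n\<close> people with \<open>m\<close> samples each: \<open>X a b\<close> is the \<open>b\<close>-th sample of person \<open>a\<close>.\<close>

type_synonym dataset = "nat \<Rightarrow> nat \<Rightarrow> vec"

definition datasets :: "nat \<Rightarrow> nat \<Rightarrow> nat \<Rightarrow> dataset measure" where
  "datasets d n m = Pi\<^sub>M {..<n} (\<lambda>_. Pi\<^sub>M {..<m} (\<lambda>_. Rd d))"

definition iid_dataset :: "nat \<Rightarrow> nat \<Rightarrow> vec measure \<Rightarrow> dataset measure" where
  "iid_dataset n m D = Pi\<^sub>M {..<n} (\<lambda>_. Pi\<^sub>M {..<m} (\<lambda>_. D))"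

definition person_neighbors :: "nat \<Rightarrow> dataset \<Rightarrow> dataset \<Rightarrow> bool" where
  "person_neighbors n X X' \<longleftrightarrow> card {a. a < n \<and> X a \<noteq> X' a} \<le> 1"

text \<open>A randomized algorithm maps a dataset to the distribution of its output.\<close>

definition person_level_DP ::
    "nat \<Rightarrow> nat \<Rightarrow> nat \<Rightarrow> real \<Rightarrow> real \<Rightarrow> (dataset \<Rightarrow> vec measure) \<Rightarrow> bool" where
  "person_level_DP d n m \<epsilon> \<delta> A \<longleftrightarrow>
     (\<forall>X \<in> space (datasets d n m). \<forall>X' \<in> space (datasets d n m). person_neighbors n X X' \<longrightarrow>
        (\<forall>Y \<in> sets (Rd d). measure (A X) Y \<le> exp \<epsilon> * measure (A X') Y + \<delta>))"

definition person_average :: "nat \<Rightarrow> nat \<Rightarrow> (nat \<Rightarrow> vec) \<Rightarrow> vec" where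
  "person_average d m x = (\<lambda>i\<in>{..<d}. (\<Sum>b<m. x b i) / real m)"

definition ball_projection :: "nat \<Rightarrow> vec \<Rightarrow> real \<Rightarrow> vec \<Rightarrow> vec" where
  "ball_projection d c \<rho> x =
     (if l2_dist d x c \<le> \<rho> then x
      else (\<lambda>i\<in>{..<d}. c i + \<rho> / l2_dist d x c * (x i - c i)))"

text \<open>The explicit formula is the metric projection: a nearest point of the ball.\<close>

lemma ball_projection_nearest:
  assumes "\<rho> \<ge> 0"
  shows "l2_dist d (ball_projection d c \<rho> x) c \<le> \<rho>"
    and "l2_dist d y c \<le> \<rho> \<Longrightarrow> l2_dist d x (ball_projection d c \<rho> x) \<le> l2_dist d x y"
proof -
  have scale: "L2_set (\<lambda>i. t * f i) {..<d} = \<bar>t\<bar> * L2_set f {..<d}" for t f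
    by (simp add: L2_set_def power_mult_distrib sum_distrib_left[symmetric] real_sqrt_mult)
  let ?r = "l2_dist d x c"
  have p: "l2_dist d (ball_projection d c \<rho> x) c = \<rho>" if "\<not> ?r \<le> \<rho>"
  proof -
    have "l2_dist d (ball_projection d c \<rho> x) c = L2_set (\<lambda>i. \<rho> / ?r * (x i - c i)) {..<d}"
      using that unfolding l2_dist_def[of d "ball_projection d c \<rho> x"] l2_norm_def
      by (intro L2_set_cong) (auto simp: ball_projection_def)
    also have "\<dots> = \<bar>\<rho> / ?r\<bar> * ?r"
      unfolding scale by (simp add: l2_dist_def l2_norm_def)
    finally show ?thesis using that assms by simp
  qed
  show "l2_dist d (ball_projection d c \<rho> x) c \<le> \<rho>"
    using p by (cases "?r \<le> \<rho>") (auto simp: ball_projection_def)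
  show "l2_dist d x (ball_projection d c \<rho> x) \<le> l2_dist d x y" if y: "l2_dist d y c \<le> \<rho>"
  proof (cases "?r \<le> \<rho>")
    case True
    then show ?thesis by (simp add: ball_projection_def l2_dist_def l2_norm_def L2_set_def sum_nonneg)
  next
    case False
    have "l2_dist d x (ball_projection d c \<rho> x) = L2_set (\<lambda>i. (1 - \<rho> / ?r) * (x i - c i)) {..<d}"
      using False unfolding l2_dist_def[of d x "ball_projection d c \<rho> x"] l2_norm_def
      by (intro L2_set_cong) (auto simp: ball_projection_def algebra_simps)
    also have "\<dots> = \<bar>1 - \<rho> / ?r\<bar> * ?r"
      unfolding scale by (simp add: l2_dist_def l2_norm_def)
    also have "\<dots> = ?r - \<rho>"
      using False assms by (simp add: field_simps)
    also have "?r \<le> l2_dist d x y + l2_dist d y c"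
      using L2_set_triangle_ineq[of "\<lambda>i. x i - y i" "\<lambda>i. y i - c i" "{..<d}"]
      by (simp add: l2_dist_def l2_norm_def)
    finally show ?thesis using y by simp
  qed
qed

definition gaussian_noise :: "nat \<Rightarrow> real \<Rightarrow> vec measure" where
  "gaussian_noise d \<sigma> = Pi\<^sub>M {..<d} (\<lambda>_. density lborel (normal_density 0 \<sigma>))"

definition clip_and_noise ::
    "nat \<Rightarrow> nat \<Rightarrow> nat \<Rightarrow> real \<Rightarrow> real \<Rightarrow> vec \<Rightarrow> dataset \<Rightarrow> vec measure" where
  "clip_and_noise d n m \<rho> \<sigma> c X =
     distr (gaussian_noise d \<sigma>) (Rd d)
       (\<lambda>z. \<lambda>i\<in>{..<d}. (\<Sum>a<n. ball_projection d c \<rho> (person_average d m (X a)) i) / real n + z i)"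

text \<open>The factor \<open>sqrt (ln (1 / \<delta>)) / \<epsilon>\<close> is the scale of the Gaussian mechanism as long as
  \<open>\<epsilon> = O(ln (1 / \<delta>))\<close>, e.g. for \<open>\<epsilon> \<le> \<epsilon>\<^sub>0\<close>, \<open>\<delta> \<le> \<delta>\<^sub>0 < 1\<close>; for larger \<open>\<epsilon>\<close> more noise is needed.\<close>

definition people_rate :: "real \<Rightarrow> nat \<Rightarrow> nat \<Rightarrow> real \<Rightarrow> real \<Rightarrow> real \<Rightarrow> real" where
  "people_rate k d m \<alpha> \<epsilon> \<delta> =
     real d / (real m * \<alpha>\<^sup>2)
   + real d * sqrt (ln (1 / \<delta>)) / (\<alpha> * sqrt (real m) * \<epsilon>)
   + real d powr ((2 * k - 1) / (2 * k - 2)) * sqrt (ln (1 / \<delta>))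
       / (\<alpha> powr (k / (k - 1)) * real m * \<epsilon>)"

text \<open>\<open>n \<ge> soft_O C p f\<close> reads: \<open>n\<close> is at least \<open>f\<close>, up to the constant \<open>C\<close> and a polylogarithmic
  factor in \<open>f\<close> itself. The summand \<open>exp 1\<close> keeps that factor at least 1.\<close>

definition soft_O :: "real \<Rightarrow> nat \<Rightarrow> real \<Rightarrow> real" where
  "soft_O C p f = C * f * ln (exp 1 + f) ^ p"

end

theory Submission
  imports Defs
begin

text \<open>
  Privacy: two neighboring clipped means differ by at most \<open>2\<rho>/n\<close>. The Renyi moment of order \<open>1 + l\<close> of two Gaussians
  at distance \<open>h\<close> is \<open>exp (l (l + 1) h\<^sup>2 / (2 \<sigma>\<^sup>2))\<close>; with \<open>l = 2 ln (1/\<delta>) / \<epsilon>\<close> the noise scale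
  \<open>\<sigma> = sqrt (K + 2) (2\<rho>/n) sqrt (ln (1/\<delta>)) / \<epsilon>\<close> suffices whenever \<open>\<epsilon> \<le> K ln (1/\<delta>)\<close>.

  Accuracy: by Markov's inequality it is enough to bound the expected error, which splits into the deviation of the
  overall sample average (second moments), the noise (second moments) and the average distance of the person averages
  to the ball. For the latter, truncate the centered samples at a radius \<open>r\<close>. The removed parts have mean norm
  \<open>O(d\<^bsup>k/2\<^esup> / r\<^bsup>k-1\<^esup>)\<close>. The truncated parts are bounded, so \<open>exp (sqrt (1 + \<bar>s\<bar>\<^sup>2))\<close>, with \<open>s\<close> their rescaled partial
  sums, grows in mean by a factor \<open>1 + O(d/r\<^sup>2)\<close> per sample; this gives a dimension-free exponential tail of the
  norm of the average, and a clipping radius that exceeds \<open>sqrt (d/m) + r/m\<close> only by a logarithmic factor.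
\<close>

section \<open>The Euclidean norm of coordinate functions\<close>

lemma l2_norm_nonneg [simp]: "0 \<le> l2_norm d v"
  by (simp add: l2_norm_def)

lemma l2_norm_power2: "(l2_norm d v)\<^sup>2 = (\<Sum>i<d. (v i)\<^sup>2)"
  by (simp add: l2_norm_def L2_set_def sum_nonneg)

lemma l2_norm_cong: "(\<And>i. i < d \<Longrightarrow> f i = g i) \<Longrightarrow> l2_norm d f = l2_norm d g"
  unfolding l2_norm_def by (intro L2_set_cong) auto

lemma l2_norm_triangle: "l2_norm d (\<lambda>i. f i + g i) \<le> l2_norm d f + l2_norm d g"
  unfolding l2_norm_def by (rule L2_set_triangle_ineq)

lemma l2_norm_scale: "l2_norm d (\<lambda>i. t * f i) = \<bar>t\<bar> * l2_norm d f"
  by (simp add: l2_norm_def L2_set_def power_mult_distrib sum_distrib_left[symmetric] real_sqrt_mult)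

lemma l2_norm_sum: "l2_norm d (\<lambda>i. \<Sum>b\<in>I. f b i) \<le> (\<Sum>b\<in>I. l2_norm d (f b))"
proof (induction I rule: infinite_finite_induct)
  case (insert b I)
  then show ?case
    using l2_norm_triangle[of d "f b" "\<lambda>i. \<Sum>b\<in>I. f b i"] by simp
qed (simp_all add: l2_norm_def L2_set_def)

lemma l2_norm_inner: "\<bar>\<Sum>i<d. f i * g i\<bar> \<le> l2_norm d f * l2_norm d g"
proof -
  have "\<bar>\<Sum>i<d. f i * g i\<bar> \<le> (\<Sum>i<d. \<bar>f i\<bar> * \<bar>g i\<bar>)"
    using sum_abs[of "\<lambda>i. f i * g i" "{..<d}"] by (simp add: abs_mult)
  also have "\<dots> \<le> l2_norm d f * l2_norm d g"
    unfolding l2_norm_def by (rule L2_set_mult_ineq)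
  finally show ?thesis .
qed

lemma l2_norm_add_power2:
  "(l2_norm d (\<lambda>i. s i + x i))\<^sup>2 = (l2_norm d s)\<^sup>2 + 2 * (\<Sum>i<d. s i * x i) + (l2_norm d x)\<^sup>2"
  by (simp add: l2_norm_power2 power2_sum sum.distrib sum_distrib_left algebra_simps)

lemma borel_measurable_l2_norm:
  "(\<And>i. i < d \<Longrightarrow> (\<lambda>x. f x i) \<in> borel_measurable M) \<Longrightarrow> (\<lambda>x. l2_norm d (f x)) \<in> borel_measurable M"
  unfolding l2_norm_def L2_set_def by (intro borel_measurable_sum measurable_compose[OF _ borel_measurable_sqrt]
    measurable_compose[OF _ borel_measurable_power]) auto

lemma measurable_Rd_component:
  "sets D = sets (Rd d) \<Longrightarrow> i < d \<Longrightarrow> (\<lambda>y. y i) \<in> borel_measurable D"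
  unfolding Rd_def by (subst measurable_cong_sets) (auto intro!: measurable_component_singleton)

lemma l2_dist_triangle: "l2_dist d x z \<le> l2_dist d x y + l2_dist d y z"
  using l2_norm_triangle[of d "\<lambda>i. x i - y i" "\<lambda>i. y i - z i"] by (simp add: l2_dist_def)

lemma l2_dist_commute: "l2_dist d x y = l2_dist d y x"
  by (simp add: l2_dist_def l2_norm_def L2_set_def power2_commute)

text \<open>A point outside the ball moves straight towards the center and stops on the sphere. The
  bias caused by clipping is thereby controlled by the excess distance alone, which is zero for most
  persons.\<close>

lemma l2_dist_ball_projection:
  assumes "\<rho> \<ge> 0"
  shows "l2_dist d (ball_projection d c \<rho> x) x \<le> max 0 (l2_dist d x c - \<rho>)"
proof (cases "l2_dist d x c \<le> \<rho>")
  case True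
  then show ?thesis by (simp add: ball_projection_def l2_dist_def l2_norm_def L2_set_def)
next
  case False
  let ?r = "l2_dist d x c"
  have "l2_dist d (ball_projection d c \<rho> x) x = l2_norm d (\<lambda>i. (\<rho> / ?r - 1) * (x i - c i))"
    unfolding l2_dist_def[of d "ball_projection d c \<rho> x"] using False
    by (intro l2_norm_cong) (simp add: ball_projection_def algebra_simps)
  also have "\<dots> = \<bar>\<rho> / ?r - 1\<bar> * ?r"
    by (simp add: l2_norm_scale l2_dist_def)
  also have "\<dots> = ?r - \<rho>"
    using False assms by (simp add: abs_if field_simps)
  finally show ?thesis by simp
qed

section \<open>Product measures\<close>

lemma measurable_PiM_apply:
  "a \<in> J \<Longrightarrow> f \<in> N \<rightarrow>\<^sub>M L \<Longrightarrow> (\<lambda>X. f (X a)) \<in> Pi\<^sub>M J (\<lambda>_. N) \<rightarrow>\<^sub>M L"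
  by (rule measurable_compose[OF measurable_component_singleton])

lemma nn_integral_PiM_component:
  assumes "\<And>i. i \<in> I \<Longrightarrow> prob_space (M i)" "i \<in> I" "f \<in> borel_measurable (M i)"
  shows "(\<integral>\<^sup>+x. f (x i) \<partial>Pi\<^sub>M I M) = (\<integral>\<^sup>+y. f y \<partial>M i)"
proof -
  have "(\<integral>\<^sup>+y. f y \<partial>M i) = (\<integral>\<^sup>+y. f y \<partial>distr (Pi\<^sub>M I M) (M i) (\<lambda>x. x i))"
    using assms by (subst distr_PiM_component) auto
  then show ?thesis
    using assms by (simp add: nn_integral_distr measurable_component_singleton)
qed

text \<open>Both sides agree on boxes, where the integral factorizes. It makes the likelihood ratio
  of two Gaussian vectors a product of one-dimensional ratios.\<close>

lemma PiM_density:
  assumes I: "finite I"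
    and M: "\<And>i. prob_space (M i)"
    and f: "\<And>i. f i \<in> borel_measurable (M i)"
    and Mf: "\<And>i. prob_space (density (M i) (f i))"
  shows "Pi\<^sub>M I (\<lambda>i. density (M i) (f i)) = density (Pi\<^sub>M I M) (\<lambda>x. \<Prod>i\<in>I. f i (x i))"
proof -
  interpret product_prob_space M I by (intro product_prob_spaceI M)
  interpret F: product_prob_space "\<lambda>i. density (M i) (f i)" I by (intro product_prob_spaceI Mf)
  note [measurable] = f
  show ?thesis
  proof (rule F.PiM_eqI[symmetric, OF I])
    show "sets (density (Pi\<^sub>M I M) (\<lambda>x. \<Prod>i\<in>I. f i (x i))) = sets (Pi\<^sub>M I (\<lambda>i. density (M i) (f i)))"
      by (simp cong: sets_PiM_cong)
    fix A assume A: "\<And>i. i \<in> I \<Longrightarrow> A i \<in> sets (density (M i) (f i))"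
    then have A' [measurable]: "\<And>i. i \<in> I \<Longrightarrow> A i \<in> sets (M i)" by simp
    have "emeasure (density (Pi\<^sub>M I M) (\<lambda>x. \<Prod>i\<in>I. f i (x i))) (Pi\<^sub>E I A)
        = (\<integral>\<^sup>+x. (\<Prod>i\<in>I. f i (x i)) * indicator (Pi\<^sub>E I A) x \<partial>Pi\<^sub>M I M)"
      using I A' by (intro emeasure_density) (auto intro!: sets_PiM_I_finite)
    also have "\<dots> = (\<integral>\<^sup>+x. (\<Prod>i\<in>I. f i (x i) * indicator (A i) (x i)) \<partial>Pi\<^sub>M I M)"
    proof (intro nn_integral_cong)
      fix x assume "x \<in> space (Pi\<^sub>M I M)"
      then have "indicator (Pi\<^sub>E I A) x = (\<Prod>i\<in>I. indicator (A i) (x i) :: ennreal)"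
        using I by (auto simp: space_PiM PiE_iff indicator_def of_bool_def prod_zero_iff)
      then show "(\<Prod>i\<in>I. f i (x i)) * indicator (Pi\<^sub>E I A) x = (\<Prod>i\<in>I. f i (x i) * indicator (A i) (x i))"
        by (simp add: prod.distrib)
    qed
    also have "\<dots> = (\<Prod>i\<in>I. \<integral>\<^sup>+y. f i y * indicator (A i) y \<partial>M i)"
      using I A' by (intro product_nn_integral_prod) auto
    also have "\<dots> = (\<Prod>i\<in>I. emeasure (density (M i) (f i)) (A i))"
      using A' by (intro prod.cong refl emeasure_density[symmetric]) auto
    finally show "emeasure (density (Pi\<^sub>M I M) (\<lambda>x. \<Prod>i\<in>I. f i (x i))) (Pi\<^sub>E I A)
        = (\<Prod>i\<in>I. emeasure (density (M i) (f i)) (A i))" .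
  qed
qed

text \<open>\<open>U j s\<close> is a potential of a random walk at \<open>s\<close>, increased to account for \<open>j\<close> steps that were integrated out.\<close>

lemma nn_integral_PiM_sum_le:
  fixes F :: "'a \<Rightarrow> vec" and U :: "nat \<Rightarrow> vec \<Rightarrow> ennreal" and I :: "'b set"
  assumes M: "prob_space M" and I: "finite I"
    and meas: "\<And>(J :: 'b set) j s. finite J \<Longrightarrow>
      (\<lambda>x. U j (\<lambda>i. s i + (\<Sum>b\<in>J. F (x b) i))) \<in> borel_measurable (Pi\<^sub>M J (\<lambda>_. M))"
    and step: "\<And>j s. (\<integral>\<^sup>+y. U j (\<lambda>i. s i + F y i) \<partial>M) \<le> U (Suc j) s"
  shows "(\<integral>\<^sup>+x. U j (\<lambda>i. s i + (\<Sum>b\<in>I. F (x b) i)) \<partial>Pi\<^sub>M I (\<lambda>_. M)) \<le> U (j + card I) s"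
  using I
proof (induction I arbitrary: j)
  case empty
  have "prob_space (Pi\<^sub>M {} (\<lambda>_::'b. M))" by (intro prob_space_PiM M)
  then show ?case by (simp add: prob_space.emeasure_space_1)
next
  case (insert b I)
  interpret product_prob_space "\<lambda>_. M" "insert b I" by (intro product_prob_spaceI M)
  \<comment> \<open>The new step \<open>b\<close> is integrated first, with the other steps frozen
    into the position. This turns \<open>U j\<close> into \<open>U (Suc j)\<close>, so the induction
    hypothesis is needed for all \<open>j\<close>.\<close>
  have "(\<integral>\<^sup>+x. U j (\<lambda>i. s i + (\<Sum>b\<in>insert b I. F (x b) i)) \<partial>Pi\<^sub>M (insert b I) (\<lambda>_. M))
      = (\<integral>\<^sup>+x. \<integral>\<^sup>+y. U j (\<lambda>i. s i + (\<Sum>b'\<in>insert b I. F ((x(b := y)) b') i)) \<partial>M \<partial>Pi\<^sub>M I (\<lambda>_. M))"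
    using insert.hyps by (intro product_nn_integral_insert meas finite.insertI)
  also have "\<dots> = (\<integral>\<^sup>+x. \<integral>\<^sup>+y. U j (\<lambda>i. (s i + (\<Sum>b\<in>I. F (x b) i)) + F y i) \<partial>M \<partial>Pi\<^sub>M I (\<lambda>_. M))"
  proof -
    have "(\<Sum>b'\<in>insert b I. F ((x(b := y)) b') i) = F y i + (\<Sum>b\<in>I. F (x b) i)" for x y i
      using insert.hyps by (auto intro!: sum.cong)
    then show ?thesis by (simp add: add_ac)
  qed
  also have "\<dots> \<le> (\<integral>\<^sup>+x. U (Suc j) (\<lambda>i. s i + (\<Sum>b\<in>I. F (x b) i)) \<partial>Pi\<^sub>M I (\<lambda>_. M))"
    by (intro nn_integral_mono step)
  also have "\<dots> \<le> U (Suc j + card I) s"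
    by (rule insert.IH)
  finally show ?case using insert.hyps by simp
qed

text \<open>From \<open>f x \<le> (f x)\<^sup>2 / \<tau> + \<tau>\<close>. The factor 2 compared
  with Cauchy-Schwarz is the price for an argument that stays with nonnegative integrals.\<close>

lemma (in prob_space) nn_integral_le_of_square:
  assumes f: "f \<in> borel_measurable M" "\<And>x. f x \<ge> 0" and \<tau>: "\<tau> > 0"
    and sq: "(\<integral>\<^sup>+x. ennreal ((f x)\<^sup>2) \<partial>M) \<le> ennreal (\<tau>\<^sup>2)"
  shows "(\<integral>\<^sup>+x. ennreal (f x) \<partial>M) \<le> ennreal (2 * \<tau>)"
proof -
  note [measurable] = f(1)
  have "(\<integral>\<^sup>+x. ennreal (f x) \<partial>M) \<le> (\<integral>\<^sup>+x. ennreal (1 / \<tau>) * ennreal ((f x)\<^sup>2) + ennreal \<tau> \<partial>M)"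
  proof (rule nn_integral_mono)
    fix x
    have "(f x - \<tau>)\<^sup>2 + f x * \<tau> \<ge> 0" using f(2)[of x] \<tau> by simp
    then have "f x * \<tau> \<le> (f x)\<^sup>2 + \<tau> * \<tau>" by (simp add: power2_eq_square algebra_simps)
    then have "f x \<le> 1 / \<tau> * (f x)\<^sup>2 + \<tau>" using \<tau> by (simp add: field_simps)
    then show "ennreal (f x) \<le> ennreal (1 / \<tau>) * ennreal ((f x)\<^sup>2) + ennreal \<tau>"
      using \<tau> by (simp add: ennreal_mult'[symmetric] ennreal_plus[symmetric] ennreal_leI del: ennreal_plus)
  qed
  also have "\<dots> = ennreal (1 / \<tau>) * (\<integral>\<^sup>+x. ennreal ((f x)\<^sup>2) \<partial>M) + ennreal \<tau>"
    by (simp add: nn_integral_add nn_integral_cmult emeasure_space_1)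
  also have "\<dots> \<le> ennreal (1 / \<tau>) * ennreal (\<tau>\<^sup>2) + ennreal \<tau>"
    by (intro add_right_mono mult_left_mono sq) simp
  also have "\<dots> = ennreal (2 * \<tau>)"
    using \<tau> by (simp add: ennreal_mult[symmetric] ennreal_plus[symmetric] power2_eq_square del: ennreal_plus)
  finally show ?thesis .
qed

section \<open>The Gaussian mechanism\<close>

definition gauss :: "real \<Rightarrow> real \<Rightarrow> real measure" where
  "gauss \<sigma> a = density lborel (normal_density a \<sigma>)"

lemma prob_space_gauss: "\<sigma> > 0 \<Longrightarrow> prob_space (gauss \<sigma> a)"
  unfolding gauss_def by (rule prob_space_normal_density)

lemma sets_gauss [simp, measurable_cong]: "sets (gauss \<sigma> a) = sets borel"
  by (simp add: gauss_def)

lemma space_gauss [simp]: "space (gauss \<sigma> a) = UNIV"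
  by (simp add: gauss_def)

text \<open>The quotient of the normal densities with means \<open>a\<close> and \<open>b\<close>
  and common deviation \<open>\<sigma>\<close>; the normalizing constants cancel.\<close>

definition gauss_ratio :: "real \<Rightarrow> real \<Rightarrow> real \<Rightarrow> real \<Rightarrow> real" where
  "gauss_ratio \<sigma> a b z = exp (((z - b)\<^sup>2 - (z - a)\<^sup>2) / (2 * \<sigma>\<^sup>2))"

lemma borel_measurable_gauss_ratio [measurable]: "gauss_ratio \<sigma> a b \<in> borel_measurable borel"
  unfolding gauss_ratio_def by measurable

lemma gauss_ratio_powr_measurable:
  "(\<lambda>z. ennreal (gauss_ratio \<sigma> a b z powr p)) \<in> borel_measurable borel"
  by measurable

lemma gauss_density_ratio:
  assumes "\<sigma> > 0"
  shows "gauss \<sigma> a = density (gauss \<sigma> b) (gauss_ratio \<sigma> a b)"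
proof -
  have "normal_density b \<sigma> z * gauss_ratio \<sigma> a b z = normal_density a \<sigma> z" for z
    by (simp add: normal_density_def gauss_ratio_def exp_add[symmetric] diff_divide_distrib)
  then have "ennreal (normal_density b \<sigma> z) * ennreal (gauss_ratio \<sigma> a b z) = ennreal (normal_density a \<sigma> z)" for z
    by (simp add: ennreal_mult[symmetric] gauss_ratio_def)
  then show ?thesis
    unfolding gauss_def by (subst density_density_eq) auto
qed

text \<open>Completing the square: the tilted density is a constant times the normal density whose
  mean \<open>b + (1 + l) * (a - b)\<close> extrapolates from \<open>b\<close> through
  \<open>a\<close>. The constant is the moment.\<close>

lemma gauss_renyi:
  assumes "\<sigma> > 0"
  shows "(\<integral>\<^sup>+z. ennreal (gauss_ratio \<sigma> a b z powr (1 + l)) \<partial>gauss \<sigma> b)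
    = ennreal (exp (l * (l + 1) * (a - b)\<^sup>2 / (2 * \<sigma>\<^sup>2)))"
proof -
  let ?b = "b + (1 + l) * (a - b)" and ?E = "exp (l * (l + 1) * (a - b)\<^sup>2 / (2 * \<sigma>\<^sup>2))"
  have eq: "normal_density b \<sigma> z * gauss_ratio \<sigma> a b z powr (1 + l) = ?E * normal_density ?b \<sigma> z" for z
  proof -
    have *: "- (z - b)\<^sup>2 + (1 + l) * ((z - b)\<^sup>2 - (z - a)\<^sup>2) = l * (l + 1) * (a - b)\<^sup>2 - (z - ?b)\<^sup>2"
      by (simp add: power2_eq_square algebra_simps)
    have "exp (- (z - b)\<^sup>2 / (2 * \<sigma>\<^sup>2)) * gauss_ratio \<sigma> a b z powr (1 + l)
        = exp ((- (z - b)\<^sup>2 + (1 + l) * ((z - b)\<^sup>2 - (z - a)\<^sup>2)) / (2 * \<sigma>\<^sup>2))"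
      by (simp add: gauss_ratio_def powr_def exp_add[symmetric] add_divide_distrib diff_divide_distrib right_diff_distrib)
    also have "\<dots> = ?E * exp (- (z - ?b)\<^sup>2 / (2 * \<sigma>\<^sup>2))"
      unfolding * by (simp add: exp_add[symmetric] diff_divide_distrib)
    finally show ?thesis
      by (simp add: normal_density_def)
  qed
  have "(\<integral>\<^sup>+z. ennreal (gauss_ratio \<sigma> a b z powr (1 + l)) \<partial>gauss \<sigma> b)
      = (\<integral>\<^sup>+z. ennreal (normal_density b \<sigma> z * gauss_ratio \<sigma> a b z powr (1 + l)) \<partial>lborel)"
    unfolding gauss_def by (subst nn_integral_density) (auto simp: ennreal_mult)
  also have "\<dots> = (\<integral>\<^sup>+z. ennreal ?E * ennreal (normal_density ?b \<sigma> z) \<partial>lborel)"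
    unfolding eq by (simp add: ennreal_mult)
  also have "\<dots> = ennreal ?E * (\<integral>\<^sup>+z. ennreal (normal_density ?b \<sigma> z) \<partial>lborel)"
    by (rule nn_integral_cmult) auto
  also have "(\<integral>\<^sup>+z. ennreal (normal_density ?b \<sigma> z) \<partial>lborel) = 1"
    using prob_space.emeasure_space_1[OF prob_space_normal_density[OF assms, of ?b]]
    by (simp add: emeasure_density)
  finally show ?thesis by simp
qed

section \<open>Gaussian vectors: shifts and privacy loss\<close>

definition gauss_vec :: "nat \<Rightarrow> real \<Rightarrow> vec \<Rightarrow> vec measure" where
  "gauss_vec d \<sigma> a = Pi\<^sub>M {..<d} (\<lambda>i. gauss \<sigma> (a i))"

lemma prob_space_gauss_vec: "\<sigma> > 0 \<Longrightarrow> prob_space (gauss_vec d \<sigma> a)"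
  unfolding gauss_vec_def by (intro prob_space_PiM prob_space_gauss)

lemma sets_gauss_vec [simp, measurable_cong]: "sets (gauss_vec d \<sigma> a) = sets (Rd d)"
  unfolding gauss_vec_def Rd_def by (intro sets_PiM_cong) auto

lemma gaussian_noise_eq: "gaussian_noise d \<sigma> = gauss_vec d \<sigma> (\<lambda>_. 0)"
  by (simp add: gaussian_noise_def gauss_vec_def gauss_def)

lemma distr_gauss_shift:
  assumes "\<sigma> > 0"
  shows "distr (gauss \<sigma> 0) borel (\<lambda>z. a + z) = gauss \<sigma> a"
proof -
  interpret prob_space "gauss \<sigma> 0" by (rule prob_space_gauss[OF assms])
  have "distributed (gauss \<sigma> 0) lborel (\<lambda>z. z) (normal_density 0 \<sigma>)"
    unfolding distributed_def gauss_def by (auto simp: distr_id2)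
  from normal_density_affine[OF this assms, of 1 a]
  have "distr (gauss \<sigma> 0) lborel (\<lambda>z. a + z) = gauss \<sigma> a"
    by (simp add: distributed_def gauss_def)
  then show ?thesis by (simp cong: distr_cong)
qed

text \<open>On a box the shift acts in each coordinate separately, which reduces the claim to
  \<open>distr_gauss_shift\<close>.\<close>

lemma distr_gaussian_noise_shift:
  assumes "\<sigma> > 0"
  shows "distr (gaussian_noise d \<sigma>) (Rd d) (\<lambda>z. \<lambda>i\<in>{..<d}. a i + z i) = gauss_vec d \<sigma> a"
proof -
  interpret product_prob_space "\<lambda>i. gauss \<sigma> (a i)" "{..<d}"
    by (intro product_prob_spaceI prob_space_gauss assms)
  interpret N: product_prob_space "\<lambda>i. gauss \<sigma> 0" "{..<d}"
    by (intro product_prob_spaceI prob_space_gauss assms)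
  have [measurable]: "(\<lambda>z. \<lambda>i\<in>{..<d}. a i + z i) \<in> Pi\<^sub>M {..<d} (\<lambda>i. gauss \<sigma> 0) \<rightarrow>\<^sub>M Rd d"
    unfolding Rd_def by (intro measurable_restrict) (auto intro!: borel_measurable_add measurable_component_singleton)
  show ?thesis
    unfolding gaussian_noise_eq gauss_vec_def
  proof (rule PiM_eqI)
    show "sets (distr (Pi\<^sub>M {..<d} (\<lambda>i. gauss \<sigma> 0)) (Rd d) (\<lambda>z. \<lambda>i\<in>{..<d}. a i + z i))
        = sets (Pi\<^sub>M {..<d} (\<lambda>i. gauss \<sigma> (a i)))"
      using sets_gauss_vec[of d \<sigma> a] by (simp add: gauss_vec_def)
    fix A assume A: "\<And>i. i \<in> {..<d} \<Longrightarrow> A i \<in> sets (gauss \<sigma> (a i))"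
    let ?B = "\<lambda>i. (\<lambda>z. a i + z) -` A i"
    have B: "?B i \<in> sets borel" if "i < d" for i
    proof -
      have "(\<lambda>z. a i + z) \<in> borel_measurable borel" by measurable
      from measurable_sets[OF this, of "A i"] show ?thesis using A[of i] that by simp
    qed
    have PA: "Pi\<^sub>E {..<d} A \<in> sets (Rd d)"
      unfolding Rd_def using A by (intro sets_PiM_I_finite) auto
    have "emeasure (distr (Pi\<^sub>M {..<d} (\<lambda>i. gauss \<sigma> 0)) (Rd d) (\<lambda>z. \<lambda>i\<in>{..<d}. a i + z i)) (Pi\<^sub>E {..<d} A)
      = emeasure (Pi\<^sub>M {..<d} (\<lambda>i. gauss \<sigma> 0)) (Pi\<^sub>E {..<d} ?B)"
      using PA
      by (subst emeasure_distr)
         (auto intro!: arg_cong2[where f=emeasure] simp: space_PiM PiE_iff extensional_def)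
    also have "\<dots> = (\<Prod>i<d. emeasure (gauss \<sigma> 0) (?B i))"
      using B by (intro N.emeasure_PiM) auto
    also have "\<dots> = (\<Prod>i<d. emeasure (gauss \<sigma> (a i)) (A i))"
    proof (intro prod.cong refl)
      fix i assume "i \<in> {..<d}"
      then show "emeasure (gauss \<sigma> 0) (?B i) = emeasure (gauss \<sigma> (a i)) (A i)"
        using A[of i] by (subst distr_gauss_shift[OF assms, symmetric]) (simp add: emeasure_distr)
    qed
    finally show "emeasure (distr (Pi\<^sub>M {..<d} (\<lambda>i. gauss \<sigma> 0)) (Rd d) (\<lambda>z. \<lambda>i\<in>{..<d}. a i + z i)) (Pi\<^sub>E {..<d} A)
      = (\<Prod>i<d. emeasure (gauss \<sigma> (a i)) (A i))" .
  qed simp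
qed

text \<open>The Renyi moment factorizes over the coordinates, and the squared shifts in the
  exponents add up to the squared Euclidean distance. The bound is therefore free of the dimension.
  The order \<open>l\<close> is left open so that it can be tuned to \<epsilon> and
  \<delta>.\<close>

lemma gauss_vec_DP:
  assumes \<sigma>: "\<sigma> > 0" and l: "l > 0" and Y: "Y \<in> sets (Rd d)"
  shows "measure (gauss_vec d \<sigma> a) Y \<le> exp \<epsilon> * measure (gauss_vec d \<sigma> b) Y
    + exp (- l * \<epsilon> + l * (l + 1) * (l2_dist d a b)\<^sup>2 / (2 * \<sigma>\<^sup>2))"
proof -
  interpret a: prob_space "gauss_vec d \<sigma> a" by (rule prob_space_gauss_vec[OF \<sigma>])
  interpret b: prob_space "gauss_vec d \<sigma> b" by (rule prob_space_gauss_vec[OF \<sigma>])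
  interpret product_prob_space "\<lambda>i. gauss \<sigma> (b i)" "{..<d}"
    by (intro product_prob_spaceI prob_space_gauss \<sigma>)
  let ?r = "\<lambda>i. gauss_ratio \<sigma> (a i) (b i)" and ?B = "gauss_vec d \<sigma> b"
  let ?g = "\<lambda>z. \<Prod>i<d. ?r i (z i)"
  let ?E = "exp (l * (l + 1) * (l2_dist d a b)\<^sup>2 / (2 * \<sigma>\<^sup>2))"
  have dens: "gauss_vec d \<sigma> a = density ?B (\<lambda>z. ennreal (?g z))"
  proof -
    have "gauss_vec d \<sigma> a = Pi\<^sub>M {..<d} (\<lambda>i. density (gauss \<sigma> (b i)) (?r i))"
      unfolding gauss_vec_def by (intro PiM_cong refl gauss_density_ratio[OF \<sigma>])
    also have "\<dots> = density ?B (\<lambda>z. \<Prod>i<d. ennreal (?r i (z i)))"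
      unfolding gauss_vec_def
      by (intro PiM_density prob_space_gauss \<sigma>)
         (auto simp flip: gauss_density_ratio[OF \<sigma>] intro: prob_space_gauss \<sigma>)
    finally show ?thesis by (simp add: prod_ennreal gauss_ratio_def)
  qed
  have comp [measurable]: "(\<lambda>z. z i) \<in> borel_measurable ?B" if "i < d" for i
    using that by (intro measurable_Rd_component) auto
  have [measurable]: "?g \<in> borel_measurable ?B"
    by (intro borel_measurable_prod measurable_compose[OF comp borel_measurable_gauss_ratio]) auto
  have [measurable]: "Y \<in> sets ?B" using Y by simp
  have gauss_ratio_powr: "(\<lambda>z. ennreal (?r i z powr (1 + l))) \<in> borel_measurable (gauss \<sigma> (b i))" for i
  proof -
    have "(\<lambda>z. ennreal (?r i z powr (1 + l))) \<in> borel_measurable borel" by (rule gauss_ratio_powr_measurable)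
    then show ?thesis by (simp cong: measurable_cong_sets)
  qed
  have g0: "?g z > 0" for z by (intro prod_pos) (simp add: gauss_ratio_def)
  \<comment> \<open>Beyond the threshold the \<open>l\<close>-th power of the normalized privacy loss is at least 1, so no tail event
    has to be split off: integrating this inequality over \<open>Y\<close> leaves a Renyi moment.\<close>
  have pw: "?g z \<le> exp \<epsilon> + exp (- l * \<epsilon>) * (?g z powr (1 + l))" for z
  proof (cases "?g z \<le> exp \<epsilon>")
    case False
    have "1 \<le> exp (- l * \<epsilon>) * (?g z powr l)"
    proof -
      have "exp (l * \<epsilon>) = exp \<epsilon> powr l" by (simp add: powr_def mult.commute)
      also have "\<dots> \<le> ?g z powr l" using False l by (intro powr_mono2) auto
      finally show ?thesis by (simp add: exp_minus field_simps)
    qed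
    then have "?g z * 1 \<le> ?g z * (exp (- l * \<epsilon>) * (?g z powr l))"
      using g0[of z] by (intro mult_left_mono) auto
    also have "\<dots> = exp (- l * \<epsilon>) * (?g z powr (1 + l))"
      using g0[of z] by (simp add: powr_add)
    finally show ?thesis using exp_gt_zero[of \<epsilon>] by linarith
  qed (simp add: add_increasing2)
  have renyi: "(\<integral>\<^sup>+z. ennreal (?g z powr (1 + l)) \<partial>?B) = ennreal ?E"
  proof -
    have "(\<integral>\<^sup>+z. ennreal (?g z powr (1 + l)) \<partial>?B) = (\<integral>\<^sup>+z. (\<Prod>i<d. ennreal (?r i (z i) powr (1 + l))) \<partial>?B)"
      by (simp add: prod_ennreal prod_powr_distrib gauss_ratio_def)
    also have "\<dots> = (\<Prod>i<d. \<integral>\<^sup>+z. ennreal (?r i z powr (1 + l)) \<partial>gauss \<sigma> (b i))"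
      unfolding gauss_vec_def by (rule product_nn_integral_prod) (use gauss_ratio_powr in auto)
    also have "\<dots> = ennreal (\<Prod>i<d. exp (l * (l + 1) * (a i - b i)\<^sup>2 / (2 * \<sigma>\<^sup>2)))"
      unfolding gauss_renyi[OF \<sigma>] by (simp add: prod_ennreal)
    also have "(\<Prod>i<d. exp (l * (l + 1) * (a i - b i)\<^sup>2 / (2 * \<sigma>\<^sup>2))) = ?E"
      by (simp add: exp_sum[symmetric] l2_dist_def l2_norm_power2 sum_distrib_left sum_divide_distrib)
    finally show ?thesis .
  qed
  have "emeasure (gauss_vec d \<sigma> a) Y = (\<integral>\<^sup>+z. ennreal (?g z) * indicator Y z \<partial>?B)"
    unfolding dens using Y by (intro emeasure_density) auto
  also have "\<dots> \<le> (\<integral>\<^sup>+z. ennreal (exp \<epsilon>) * indicator Y z + ennreal (exp (- l * \<epsilon>)) * ennreal (?g z powr (1 + l)) \<partial>?B)"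
  proof (intro nn_integral_mono)
    fix z
    show "ennreal (?g z) * indicator Y z
        \<le> ennreal (exp \<epsilon>) * indicator Y z + ennreal (exp (- l * \<epsilon>)) * ennreal (?g z powr (1 + l))"
      using pw[of z] g0[of z]
      by (cases "z \<in> Y") (auto simp flip: ennreal_mult ennreal_plus intro!: ennreal_leI)
  qed
  also have "\<dots> = ennreal (exp \<epsilon>) * emeasure ?B Y + ennreal (exp (- l * \<epsilon>)) * ennreal ?E"
    unfolding renyi[symmetric]
    using Y by (subst nn_integral_add) (auto simp: nn_integral_cmult)
  also have "\<dots> = ennreal (exp \<epsilon> * measure ?B Y + exp (- l * \<epsilon>) * ?E)"
    by (simp add: b.emeasure_eq_measure ennreal_mult)
  finally have "ennreal (measure (gauss_vec d \<sigma> a) Y) \<le> ennreal (exp \<epsilon> * measure ?B Y + exp (- l * \<epsilon>) * ?E)"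
    unfolding a.emeasure_eq_measure .
  then have "measure (gauss_vec d \<sigma> a) Y \<le> exp \<epsilon> * measure ?B Y + exp (- l * \<epsilon>) * ?E"
    by (subst (asm) ennreal_le_iff) (auto intro!: add_nonneg_nonneg)
  then show ?thesis by (simp add: exp_add[symmetric])
qed

lemma gauss_second_moment:
  assumes "\<sigma> > 0"
  shows "(\<integral>\<^sup>+z. ennreal (z\<^sup>2) \<partial>gauss \<sigma> 0) = ennreal (\<sigma>\<^sup>2)"
proof -
  have "(\<integral>\<^sup>+z. ennreal (z\<^sup>2) \<partial>gauss \<sigma> 0) = (\<integral>\<^sup>+z. ennreal (normal_density 0 \<sigma> z * (z - 0) ^ (2 * 1)) \<partial>lborel)"
    unfolding gauss_def by (subst nn_integral_density) (auto simp: ennreal_mult)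
  also have "\<dots> = ennreal (fact (2 * 1) / ((2 / \<sigma>\<^sup>2) ^ 1 * fact 1))"
    using normal_moment_even[OF assms, of 0 1]
    by (subst nn_integral_eq_integral)
       (auto simp: has_bochner_integral_iff)
  finally show ?thesis using assms by simp
qed

lemma gaussian_noise_norm:
  assumes \<sigma>: "\<sigma> > 0" and \<tau>: "\<tau> > 0" "real d * \<sigma>\<^sup>2 \<le> \<tau>\<^sup>2"
  shows "(\<integral>\<^sup>+z. ennreal (l2_norm d z) \<partial>gaussian_noise d \<sigma>) \<le> ennreal (2 * \<tau>)"
proof -
  interpret prob_space "gaussian_noise d \<sigma>"
    unfolding gaussian_noise_eq by (rule prob_space_gauss_vec[OF \<sigma>])
  have comp: "(\<lambda>z. z i) \<in> borel_measurable (gaussian_noise d \<sigma>)" if "i < d" for i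
    using that unfolding gaussian_noise_eq by (intro measurable_Rd_component) auto
  show ?thesis
  proof (rule nn_integral_le_of_square)
    show "(\<lambda>z. l2_norm d z) \<in> borel_measurable (gaussian_noise d \<sigma>)"
      by (intro borel_measurable_l2_norm comp)
    have "(\<integral>\<^sup>+z. ennreal ((l2_norm d z)\<^sup>2) \<partial>gaussian_noise d \<sigma>)
        = (\<integral>\<^sup>+z. (\<Sum>i<d. ennreal ((z i)\<^sup>2)) \<partial>gaussian_noise d \<sigma>)"
      by (simp add: l2_norm_power2)
    also have "\<dots> = (\<Sum>i<d. \<integral>\<^sup>+z. ennreal ((z i)\<^sup>2) \<partial>gaussian_noise d \<sigma>)"
    proof (rule nn_integral_sum)
      fix i assume "i \<in> {..<d}"
      then have "(\<lambda>z. z i) \<in> borel_measurable (gaussian_noise d \<sigma>)" by (intro comp) simp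
      then show "(\<lambda>z. ennreal ((z i)\<^sup>2)) \<in> borel_measurable (gaussian_noise d \<sigma>)" by measurable
    qed
    also have "\<dots> = (\<Sum>i<d. ennreal (\<sigma>\<^sup>2))"
    proof (rule sum.cong)
      fix i assume "i \<in> {..<d}"
      then show "(\<integral>\<^sup>+z. ennreal ((z i)\<^sup>2) \<partial>gaussian_noise d \<sigma>) = ennreal (\<sigma>\<^sup>2)"
        unfolding gaussian_noise_def gauss_def[symmetric]
        by (subst nn_integral_PiM_component[where f = "\<lambda>t. ennreal (t\<^sup>2)"])
           (auto intro: prob_space_gauss[OF \<sigma>] simp: gauss_second_moment[OF \<sigma>])
    qed simp
    also have "\<dots> = ennreal (real d * \<sigma>\<^sup>2)"
      by (simp add: ennreal_mult ennreal_of_nat_eq_real_of_nat)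
    also have "\<dots> \<le> ennreal (\<tau>\<^sup>2)" using \<tau>(2) by (rule ennreal_leI)
    finally show "(\<integral>\<^sup>+z. ennreal ((l2_norm d z)\<^sup>2) \<partial>gaussian_noise d \<sigma>) \<le> ennreal (\<tau>\<^sup>2)" .
  qed (use \<tau> in auto)
qed

section \<open>Privacy of clip-and-noise\<close>

definition clipped_mean :: "nat \<Rightarrow> nat \<Rightarrow> nat \<Rightarrow> real \<Rightarrow> vec \<Rightarrow> dataset \<Rightarrow> vec" where
  "clipped_mean d n m \<rho> c X i = (\<Sum>a<n. ball_projection d c \<rho> (person_average d m (X a)) i) / real n"

lemma clip_and_noise_eq:
  "\<sigma> > 0 \<Longrightarrow> clip_and_noise d n m \<rho> \<sigma> c X = gauss_vec d \<sigma> (clipped_mean d n m \<rho> c X)"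
  unfolding clip_and_noise_def clipped_mean_def[symmetric] by (rule distr_gaussian_noise_shift)

text \<open>At most one summand changes, and both of its values lie in the same ball of radius
  \<rho>, hence at distance at most \<open>2 * \<rho>\<close>.\<close>

lemma clipped_mean_sensitivity:
  assumes "person_neighbors n X X'" and n: "n > 0" and \<rho>: "\<rho> \<ge> 0"
  shows "l2_dist d (clipped_mean d n m \<rho> c X) (clipped_mean d n m \<rho> c X') \<le> 2 * \<rho> / real n"
proof -
  let ?p = "\<lambda>X a. ball_projection d c \<rho> (person_average d m (X a))"
  let ?S = "{a. a < n \<and> X a \<noteq> X' a}"
  have dist: "l2_dist d (?p X a) (?p X' a) \<le> 2 * \<rho>" for a
  proof -
    have "l2_dist d (?p X a) (?p X' a) \<le> l2_dist d (?p X a) c + l2_dist d (?p X' a) c"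
      using l2_dist_triangle[of d "?p X a" "?p X' a" c] l2_dist_commute[of d c "?p X' a"] by linarith
    then show ?thesis
      using ball_projection_nearest(1)[OF \<rho>, of d c "person_average d m (X a)"]
        ball_projection_nearest(1)[OF \<rho>, of d c "person_average d m (X' a)"] by linarith
  qed
  have sum: "(\<Sum>a<n. ?p X a i - ?p X' a i) = (\<Sum>a\<in>?S. ?p X a i - ?p X' a i)" for i
    by (rule sum.mono_neutral_right) auto
  have "l2_dist d (clipped_mean d n m \<rho> c X) (clipped_mean d n m \<rho> c X')
      = l2_norm d (\<lambda>i. (1 / real n) * (\<Sum>a\<in>?S. ?p X a i - ?p X' a i))"
    unfolding l2_dist_def sum[symmetric]
    by (intro l2_norm_cong) (simp add: clipped_mean_def diff_divide_distrib sum_subtractf)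
  then have eq: "l2_dist d (clipped_mean d n m \<rho> c X) (clipped_mean d n m \<rho> c X')
      = l2_norm d (\<lambda>i. \<Sum>a\<in>?S. ?p X a i - ?p X' a i) / real n"
    by (simp only: l2_norm_scale) simp
  have "l2_norm d (\<lambda>i. \<Sum>a\<in>?S. ?p X a i - ?p X' a i) \<le> (\<Sum>a\<in>?S. l2_dist d (?p X a) (?p X' a))"
    unfolding l2_dist_def by (rule l2_norm_sum[of d "\<lambda>a i. ?p X a i - ?p X' a i" ?S])
  also have "\<dots> \<le> real (card ?S) * (2 * \<rho>)"
    by (rule sum_bounded_above) (rule dist)
  also have "\<dots> \<le> 1 * (2 * \<rho>)"
    using assms(1) \<rho> by (intro mult_right_mono) (auto simp: person_neighbors_def)
  finally show ?thesis
    unfolding eq using n by (simp add: divide_right_mono)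
qed

lemma clip_and_noise_DP:
  assumes n: "n > 0" and \<rho>: "\<rho> > 0" and \<epsilon>: "\<epsilon> > 0" and \<delta>: "0 < \<delta>" "\<delta> < 1"
    and K: "\<epsilon> \<le> K * ln (1 / \<delta>)" "K > 0"
    and \<sigma>: "\<sigma> = sqrt (K + 2) * (2 * \<rho> / real n) * sqrt (ln (1 / \<delta>)) / \<epsilon>"
  shows "person_level_DP d n m \<epsilon> \<delta> (clip_and_noise d n m \<rho> \<sigma> c)"
  unfolding person_level_DP_def
proof (intro ballI impI)
  fix X X' Y
  assume nb: "person_neighbors n X X'" and Y: "Y \<in> sets (Rd d)"
  define L where "L = ln (1 / \<delta>)"
  have L: "L > 0" using \<delta> by (simp add: L_def)
  have \<sigma>0: "\<sigma> > 0" unfolding \<sigma> using n \<rho> \<epsilon> K L by (simp add: L_def)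
  let ?a = "clipped_mean d n m \<rho> c X" and ?b = "clipped_mean d n m \<rho> c X'"
  \<comment> \<open>This order makes the linear term of the exponent equal to
    \<open>- 2 * L\<close>. The Renyi term becomes \<open>(2 * L + \<epsilon>) / (K + 2)\<close>,
    which is at most \<open>L\<close> because \<open>\<epsilon> \<le> K * L\<close>; this is where
    the factor \<open>K + 2\<close> in \<open>\<sigma>\<^sup>2\<close> comes from. The remaining
    \<open>- L\<close> is \<open>ln \<delta>\<close>.\<close>
  let ?l = "2 * L / \<epsilon>"
  have l: "?l > 0" using L \<epsilon> by simp
  let ?s = "(2 * \<rho> / real n)\<^sup>2 / (2 * \<sigma>\<^sup>2)"
  have s: "?s = \<epsilon>\<^sup>2 / (2 * (K + 2) * L)"
  proof -
    define h where "h = 2 * \<rho> / real n"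
    have "h > 0" using n \<rho> by (simp add: h_def)
    moreover have "\<sigma>\<^sup>2 = (K + 2) * h\<^sup>2 * L / \<epsilon>\<^sup>2"
      unfolding \<sigma> using K L by (simp add: h_def[symmetric] L_def[symmetric] power_mult_distrib power_divide)
    ultimately show ?thesis
      using \<epsilon> by (simp add: h_def[symmetric])
  qed
  have "- ?l * \<epsilon> + ?l * (?l + 1) * (l2_dist d ?a ?b)\<^sup>2 / (2 * \<sigma>\<^sup>2) \<le> - ?l * \<epsilon> + ?l * (?l + 1) * ?s"
    unfolding times_divide_eq_right[symmetric]
    using clipped_mean_sensitivity[OF nb n, of \<rho> d m c] \<rho> l L \<epsilon>
    by (intro add_left_mono mult_left_mono divide_right_mono power_mono) (auto simp: l2_dist_def)
  also have "\<dots> = - 2 * L + (2 * L + \<epsilon>) / (K + 2)"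
  proof -
    have "?l * (?l + 1) * \<epsilon>\<^sup>2 = 2 * L * (2 * L + \<epsilon>)"
      using \<epsilon> by (simp add: field_simps power2_eq_square)
    then show ?thesis
      unfolding s using \<epsilon> L K by (simp add: divide_simps) (simp add: algebra_simps)
  qed
  also have "\<dots> \<le> - 2 * L + (2 * L + K * L) / (K + 2)"
    using K by (intro add_left_mono divide_right_mono) (auto simp: L_def)
  also have "\<dots> = ln \<delta>"
  proof -
    have "(2 * L + K * L) / (K + 2) = L" using K by (simp add: field_simps)
    then show ?thesis using \<delta> by (simp add: L_def ln_div)
  qed
  finally have "exp (- ?l * \<epsilon> + ?l * (?l + 1) * (l2_dist d ?a ?b)\<^sup>2 / (2 * \<sigma>\<^sup>2)) \<le> \<delta>"
    using \<delta> by (simp add: ln_ge_iff)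
  then show "measure (clip_and_noise d n m \<rho> \<sigma> c X) Y
      \<le> exp \<epsilon> * measure (clip_and_noise d n m \<rho> \<sigma> c X') Y + \<delta>"
    using gauss_vec_DP[OF \<sigma>0 l Y, of ?a \<epsilon> ?b] unfolding clip_and_noise_eq[OF \<sigma>0] by linarith
qed

section \<open>Exponential moments of the norm of a random walk\<close>

text \<open>For negative arguments the lower Taylor bound of the exponential is inverted: the
  product of \<open>1 + x + x\<^sup>2 / 2\<close> and \<open>1 - x + x\<^sup>2\<close> is at least 1
  for positive \<open>x\<close>.\<close>

lemma exp_le_quadratic: "exp y \<le> 1 + y + y\<^sup>2" if "y \<le> 1" for y :: real
proof (cases "y \<ge> 0")
  case False
  define x where "x = - y"
  have x: "x > 0" using False by (simp add: x_def)
  have "1 \<le> (1 + x + x\<^sup>2 / 2) * (1 - x + x\<^sup>2)"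
  proof -
    have "(1 + x + x\<^sup>2 / 2) * (1 - x + x\<^sup>2) = 1 + x\<^sup>2 / 2 + x ^ 3 / 2 + x ^ 4 / 2"
      by (simp add: field_simps power2_eq_square power3_eq_cube power4_eq_xxxx)
    then show ?thesis using x by simp
  qed
  also have "\<dots> \<le> exp x * (1 - x + x\<^sup>2)"
  proof (rule mult_right_mono)
    show "1 + x + x\<^sup>2 / 2 \<le> exp x" using x exp_lower_Taylor_quadratic[of x] by simp
    have "(x - 1 / 2)\<^sup>2 \<ge> 0" by simp
    then show "0 \<le> 1 - x + x\<^sup>2" by (simp add: power2_eq_square algebra_simps)
  qed
  finally have "exp (- x) \<le> 1 - x + x\<^sup>2"
    by (simp add: exp_minus field_simps)
  then show ?thesis by (simp add: x_def)
qed (use that exp_bound in auto)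

text \<open>The quotient is the length of the gradient of
  \<open>sqrt (1 + (l2_norm d s)\<^sup>2)\<close> at \<open>s\<close>, so that function has slope at
  most 1 in every direction.\<close>

lemma l2_norm_div_sqrt_le_1: "l2_norm d s / sqrt (1 + (l2_norm d s)\<^sup>2) \<le> 1"
proof -
  have "sqrt (1 + (l2_norm d s)\<^sup>2) > 0" by (simp add: add_pos_nonneg)
  moreover have "l2_norm d s \<le> sqrt (1 + (l2_norm d s)\<^sup>2)" by (rule real_le_rsqrt) simp
  ultimately show ?thesis by simp
qed

text \<open>Replacing \<open>exp (l2_norm d s)\<close> by \<open>exp (sqrt (1 + (l2_norm d s)\<^sup>2))\<close> makes the increment of the exponent linear
  in \<open>x\<close> up to a quadratic error, by concavity of the square root.\<close>

lemma exp_sqrt_norm_step: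
  fixes d :: nat and s x :: vec
  defines "p \<equiv> sqrt (1 + (l2_norm d s)\<^sup>2)"
  assumes x: "l2_norm d x \<le> 1 / 2"
  shows "exp (sqrt (1 + (l2_norm d (\<lambda>i. s i + x i))\<^sup>2))
    \<le> exp p * (1 + (\<Sum>i<d. s i / p * x i) + 5 / 2 * (l2_norm d x)\<^sup>2)"
proof -
  define t where "t = (\<Sum>i<d. s i / p * x i)"
  define r where "r = l2_norm d x"
  have r: "0 \<le> r" "r \<le> 1 / 2" using x by (simp_all add: r_def)
  have p: "p \<ge> 1" "p\<^sup>2 = 1 + (l2_norm d s)\<^sup>2" by (simp_all add: p_def)
  have "l2_norm d (\<lambda>i. s i / p) = l2_norm d s / p"
    using l2_norm_scale[of d "1 / p" s] p by simp
  also have "\<dots> \<le> 1"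
    unfolding p_def by (rule l2_norm_div_sqrt_le_1)
  finally have t: "\<bar>t\<bar> \<le> r"
    using l2_norm_inner[of "\<lambda>i. s i / p" x d] mult_right_mono[of "l2_norm d (\<lambda>i. s i / p)" 1 r] r
    unfolding t_def r_def by simp
  \<comment> \<open>An upper bound for the increment of the square root: \<open>2 * p * y\<close>
    equals \<open>2 * p * t + p * r\<^sup>2\<close>, and \<open>p \<ge> 1\<close> lets it absorb the
    quadratic term \<open>r\<^sup>2\<close>. Since \<open>r \<le> 1 / 2\<close>, also \<bar>y\<bar>
    is at most \<open>5 / 8\<close>, within the range of \<open>exp_le_quadratic\<close>. The final
    coefficient \<open>5 / 2\<close> is \<open>1 / 2\<close> from \<open>y\<close> plus 2 from its
    square.\<close>
  define y where "y = t + r\<^sup>2 / 2"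
  have r2: "r\<^sup>2 \<le> r / 2" using r mult_left_mono[of r "1 / 2" r] by (simp add: power2_eq_square)
  have y: "\<bar>y\<bar> \<le> 5 / 4 * r" using t r2 zero_le_power2[of r] unfolding y_def by linarith
  have inner: "(\<Sum>i<d. s i * x i) = p * t"
    using p by (simp add: t_def sum_distrib_left)
  have "sqrt (1 + (l2_norm d (\<lambda>i. s i + x i))\<^sup>2) \<le> p + y"
  proof (rule real_le_lsqrt)
    show "0 \<le> p + y" using p y r by linarith
    have "1 + (l2_norm d (\<lambda>i. s i + x i))\<^sup>2 = p\<^sup>2 + 2 * (p * t) + r\<^sup>2"
      by (simp add: l2_norm_add_power2 p inner r_def)
    also have "\<dots> \<le> p\<^sup>2 + 2 * p * y"
      using p(1) mult_right_mono[of 1 p "r\<^sup>2"] by (simp add: y_def algebra_simps)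
    also have "\<dots> \<le> (p + y)\<^sup>2" by (simp add: power2_sum)
    finally show "1 + (l2_norm d (\<lambda>i. s i + x i))\<^sup>2 \<le> (p + y)\<^sup>2" .
  qed
  then have "exp (sqrt (1 + (l2_norm d (\<lambda>i. s i + x i))\<^sup>2)) \<le> exp p * exp y"
    by (simp add: exp_add[symmetric])
  also have "exp y \<le> 1 + y + y\<^sup>2"
    using y r by (intro exp_le_quadratic) linarith
  also have "\<dots> \<le> 1 + t + 5 / 2 * r\<^sup>2"
  proof -
    have "y\<^sup>2 \<le> (5 / 4 * r)\<^sup>2" using y by (rule abs_le_square_iff[THEN iffD1, OF order_trans]) simp
    also have "\<dots> \<le> 2 * r\<^sup>2" by (simp add: power_mult_distrib power2_eq_square)
    finally show ?thesis by (simp add: y_def)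
  qed
  finally show ?thesis by (simp add: t_def r_def)
qed

section \<open>Distributions with bounded directional moments\<close>

locale bounded_moment = prob_space D for D :: "vec measure" +
  fixes d :: nat and \<mu> :: vec and k :: real
  assumes sets_D [measurable_cong]: "sets D = sets (Rd d)"
    and mean: "has_mean d D \<mu>"
    and moment: "moment_bounded d k D \<mu>"
    and k: "k > 2"
begin

lemma component [measurable]: "i < d \<Longrightarrow> (\<lambda>y. y i) \<in> borel_measurable D"
  by (rule measurable_Rd_component[OF sets_D])

lemma dist_measurable [measurable]: "(\<lambda>y. l2_dist d y c) \<in> borel_measurable D"
  unfolding l2_dist_def by (intro borel_measurable_l2_norm borel_measurable_diff component) auto

text \<open>The directional bound tested at the \<open>i\<close>-th unit vector, restricted to the
  first \<open>d\<close> coordinates so that it lies in \<open>space (Rd d)\<close>. The moment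
  hypothesis enters the later estimates through this bound.\<close>

lemma coord_moment:
  assumes i: "i < d"
  shows "(\<integral>\<^sup>+y. ennreal (\<bar>y i - \<mu> i\<bar> powr k) \<partial>D) \<le> 1"
proof -
  define v where "v = (\<lambda>j\<in>{..<d}. if j = i then 1 else 0 :: real)"
  have v: "v \<in> space (Rd d)" by (auto simp: v_def Rd_def space_PiM)
  have "(\<Sum>j<d. (v j)\<^sup>2) = (\<Sum>j<d. if j = i then 1 else 0)"
    by (intro sum.cong) (auto simp: v_def)
  then have n: "l2_norm d v = 1" using i by (simp add: l2_norm_def L2_set_def)
  have s: "(\<Sum>j<d. (y j - \<mu> j) * v j) = y i - \<mu> i" for y
  proof -
    have "(\<Sum>j<d. (y j - \<mu> j) * v j) = (\<Sum>j<d. if j = i then y i - \<mu> i else 0)"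
      by (intro sum.cong) (auto simp: v_def)
    then show ?thesis using i by simp
  qed
  have "(\<integral>\<^sup>+y. ennreal (\<bar>\<Sum>j<d. (y j - \<mu> j) * v j\<bar> powr k) \<partial>D) \<le> 1"
    using moment v n unfolding moment_bounded_def by (simp add: SUP_le_iff)
  then show ?thesis by (simp only: s)
qed

text \<open>The elementary bound of \<open>t\<^sup>2\<close> by
  \<open>1 + \<bar>t\<bar> powr k\<close> replaces Jensen's inequality, at the cost of the constant
  2.\<close>

lemma coord_square:
  assumes i: "i < d"
  shows "integrable D (\<lambda>y. (y i - \<mu> i)\<^sup>2)" and "(\<integral>y. (y i - \<mu> i)\<^sup>2 \<partial>D) \<le> 2"
proof -
  note component[OF i, measurable]
  have pw: "t\<^sup>2 \<le> 1 + \<bar>t\<bar> powr k" for t :: real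
  proof (cases "\<bar>t\<bar> \<le> 1")
    case True
    then have "t\<^sup>2 \<le> 1" by (simp add: abs_square_le_1)
    then show ?thesis using powr_ge_zero[of "\<bar>t\<bar>" k] by linarith
  next
    case False
    then have "\<bar>t\<bar> powr 2 \<le> \<bar>t\<bar> powr k" using k by (intro powr_mono) auto
    then show ?thesis using False by (simp add: powr_numeral)
  qed
  have le: "(\<integral>\<^sup>+y. ennreal ((y i - \<mu> i)\<^sup>2) \<partial>D) \<le> ennreal 2"
  proof -
    have "(\<integral>\<^sup>+y. ennreal ((y i - \<mu> i)\<^sup>2) \<partial>D) \<le> (\<integral>\<^sup>+y. 1 + ennreal (\<bar>y i - \<mu> i\<bar> powr k) \<partial>D)"
      using pw by (intro nn_integral_mono) (metis ennreal_1 ennreal_leI ennreal_plus powr_ge_zero zero_le_one)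
    also have "\<dots> = 1 + (\<integral>\<^sup>+y. ennreal (\<bar>y i - \<mu> i\<bar> powr k) \<partial>D)"
      by (subst nn_integral_add) (auto simp: emeasure_space_1)
    also have "\<dots> \<le> 1 + 1" by (intro add_left_mono coord_moment i)
    finally show ?thesis by simp
  qed
  show int: "integrable D (\<lambda>y. (y i - \<mu> i)\<^sup>2)"
    using le by (intro integrableI_bounded) (auto intro: le_less_trans)
  show "(\<integral>y. (y i - \<mu> i)\<^sup>2 \<partial>D) \<le> 2"
    using le nn_integral_eq_integral[OF int] by (simp add: ennreal_le_iff del: ennreal_numeral)
qed

lemma dist_square:
  shows "integrable D (\<lambda>y. (l2_dist d y \<mu>)\<^sup>2)" and "(\<integral>y. (l2_dist d y \<mu>)\<^sup>2 \<partial>D) \<le> 2 * real d"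
proof -
  show "integrable D (\<lambda>y. (l2_dist d y \<mu>)\<^sup>2)"
    unfolding l2_dist_def l2_norm_power2 using coord_square(1) by (intro Bochner_Integration.integrable_sum) auto
  have "(\<integral>y. (l2_dist d y \<mu>)\<^sup>2 \<partial>D) = (\<Sum>i<d. \<integral>y. (y i - \<mu> i)\<^sup>2 \<partial>D)"
    unfolding l2_dist_def l2_norm_power2 using coord_square(1) by (intro Bochner_Integration.integral_sum) auto
  also have "\<dots> \<le> (\<Sum>i<d. 2)" using coord_square(2) by (intro sum_mono) auto
  finally show "(\<integral>y. (l2_dist d y \<mu>)\<^sup>2 \<partial>D) \<le> 2 * real d" by simp
qed

lemma inner_mean:
  shows "integrable D (\<lambda>y. \<Sum>i<d. v i * (y i - \<mu> i))" and "(\<integral>y. (\<Sum>i<d. v i * (y i - \<mu> i)) \<partial>D) = 0"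
proof -
  have *: "integrable D (\<lambda>y. v i * (y i - \<mu> i))" "(\<integral>y. v i * (y i - \<mu> i) \<partial>D) = 0" if "i < d" for i
    using mean that by (auto simp: has_mean_def prob_space)
  show "integrable D (\<lambda>y. \<Sum>i<d. v i * (y i - \<mu> i))"
    using * by (intro Bochner_Integration.integrable_sum) auto
  have "(\<integral>y. (\<Sum>i<d. v i * (y i - \<mu> i)) \<partial>D) = (\<Sum>i<d. \<integral>y. v i * (y i - \<mu> i) \<partial>D)"
    using * by (intro Bochner_Integration.integral_sum) auto
  then show "(\<integral>y. (\<Sum>i<d. v i * (y i - \<mu> i)) \<partial>D) = 0" using *(2) by (simp del: Bochner_Integration.integral_mult_right_zero)
qed

text \<open>Coordinates of size at most \<open>b\<close> contribute at most a quarter of the squared norm on the tail event, so the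
  \<open>k\<close>-th powers of the coordinates control the norm there.\<close>

lemma tail_bound:
  assumes d: "d > 0" and b: "b > 0"
  shows "(\<integral>\<^sup>+y. ennreal (if l2_dist d y \<mu> > 2 * sqrt d * b then l2_dist d y \<mu> else 0) \<partial>D)
    \<le> ennreal (sqrt d * b powr (1 - k))"
proof -
  let ?S = "\<lambda>y. \<Sum>i<d. \<bar>y i - \<mu> i\<bar> powr k"
  let ?c = "b powr (1 - k) / sqrt d"
  have co: "t\<^sup>2 \<le> b\<^sup>2 + b powr (2 - k) * \<bar>t\<bar> powr k" for t
  proof (cases "\<bar>t\<bar> \<le> b")
    case True
    then have "t\<^sup>2 \<le> b\<^sup>2" by (metis abs_le_square_iff abs_of_pos b)
    then show ?thesis by (simp add: add_increasing2)
  next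
    case False
    have "t\<^sup>2 = \<bar>t\<bar> powr (2 - k) * \<bar>t\<bar> powr k"
      using False b by (simp add: powr_add[symmetric])
    also have "\<dots> \<le> b powr (2 - k) * \<bar>t\<bar> powr k"
      using False b k by (intro mult_right_mono powr_mono2') auto
    finally show ?thesis by (simp add: add_increasing)
  qed
  have pw: "(if l2_dist d y \<mu> > 2 * sqrt d * b then l2_dist d y \<mu> else 0) \<le> ?c * ?S y" for y
  proof (cases "l2_dist d y \<mu> > 2 * sqrt d * b")
    case True
    define r where "r = l2_dist d y \<mu>"
    define R where "R = 2 * sqrt d * b"
    have R: "R > 0" "r > R" using True d b by (simp_all add: R_def r_def)
    have "r\<^sup>2 \<le> (\<Sum>i<d. b\<^sup>2 + b powr (2 - k) * \<bar>y i - \<mu> i\<bar> powr k)"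
      unfolding r_def l2_dist_def l2_norm_power2 by (intro sum_mono co)
    also have "\<dots> = R\<^sup>2 / 4 + b powr (2 - k) * ?S y"
      by (simp add: sum.distrib R_def power_mult_distrib sum_distrib_left)
    finally have "r\<^sup>2 \<le> R\<^sup>2 / 4 + b powr (2 - k) * ?S y" .
    moreover have "R\<^sup>2 \<le> r\<^sup>2" using R by (intro power_mono) auto
    ultimately have "r\<^sup>2 * (3 / 4) \<le> b powr (2 - k) * ?S y" by linarith
    moreover have "b powr (2 - k) * ?S y \<ge> 0" by (intro mult_nonneg_nonneg sum_nonneg) auto
    ultimately have r2: "r\<^sup>2 \<le> 2 * (b powr (2 - k) * ?S y)" by linarith
    \<comment> \<open>On the tail event \<open>r > R\<close>, so dividing the bound on the square by
      \<open>R\<close> gives one on \<open>r\<close> itself. With \<open>R = 2 * sqrt d * b\<close>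
      this produces the constant \<open>?c\<close>; summing \<open>d\<close> moments later turns its
      \<open>1 / sqrt d\<close> into \<open>sqrt d\<close>.\<close>
    have "r * R \<le> r\<^sup>2" using R by (simp add: power2_eq_square)
    then have "r \<le> 2 * (b powr (2 - k) * ?S y) / R" using R r2 by (simp add: pos_le_divide_eq)
    also have "\<dots> = ?c * ?S y"
    proof -
      have "b powr (2 - k) = b * b powr (1 - k)"
        using b by (simp add: powr_mult_base)
      then show ?thesis using b d by (simp add: R_def field_simps)
    qed
    finally show ?thesis using True by (simp add: r_def)
  next
    case False
    then show ?thesis by (simp add: sum_nonneg)
  qed
  have "(\<integral>\<^sup>+y. ennreal (if l2_dist d y \<mu> > 2 * sqrt d * b then l2_dist d y \<mu> else 0) \<partial>D)
      \<le> (\<integral>\<^sup>+y. ennreal ?c * (\<Sum>i<d. ennreal (\<bar>y i - \<mu> i\<bar> powr k)) \<partial>D)"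
  proof (rule nn_integral_mono)
    fix y
    show "ennreal (if l2_dist d y \<mu> > 2 * sqrt d * b then l2_dist d y \<mu> else 0)
        \<le> ennreal ?c * (\<Sum>i<d. ennreal (\<bar>y i - \<mu> i\<bar> powr k))"
      using ennreal_leI[OF pw[of y]] by (simp only: sum_ennreal powr_ge_zero ennreal_mult' sum_nonneg)
        (subst ennreal_mult'[symmetric], auto intro: sum_nonneg)
  qed
  also have "\<dots> = ennreal ?c * (\<integral>\<^sup>+y. (\<Sum>i<d. ennreal (\<bar>y i - \<mu> i\<bar> powr k)) \<partial>D)"
    by (intro nn_integral_cmult borel_measurable_sum) (use component in measurable)
  also have "(\<integral>\<^sup>+y. (\<Sum>i<d. ennreal (\<bar>y i - \<mu> i\<bar> powr k)) \<partial>D) = (\<Sum>i<d. \<integral>\<^sup>+y. ennreal (\<bar>y i - \<mu> i\<bar> powr k) \<partial>D)"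
    by (intro nn_integral_sum) (use component in measurable)
  also have "\<dots> \<le> (\<Sum>i<d. 1)" using coord_moment by (intro sum_mono) auto
  also have "\<dots> = ennreal d" by (simp add: ennreal_of_nat_eq_real_of_nat)
  also have "ennreal ?c * ennreal d = ennreal (sqrt d * b powr (1 - k))"
    using d by (simp add: ennreal_mult[symmetric] field_simps real_div_sqrt)
  finally show ?thesis by (simp add: mult_left_mono)
qed

text \<open>The truncated centered sample in units of \<open>Q\<close>. Truncating at
  \<open>Q / 2\<close> keeps its norm within \<open>1 / 2\<close>, the step size that
  \<open>exp_sqrt_norm_step\<close> allows.\<close>

definition core :: "real \<Rightarrow> vec \<Rightarrow> vec" where
  "core Q y i = (if l2_dist d y \<mu> \<le> Q / 2 then (y i - \<mu> i) / Q else 0)"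

lemma core_measurable: "i < d \<Longrightarrow> (\<lambda>y. core Q y i) \<in> borel_measurable D"
  unfolding core_def by measurable

text \<open>The truncated vector is not centered, but its mean differs from 0 by at most the mean of the truncated part,
  which is again of the order of the second moment divided by \<open>Q\<^sup>2\<close>.\<close>

lemma core_step:
  assumes Q: "Q > 0"
  shows "(\<integral>\<^sup>+y. ennreal (exp (sqrt (1 + (l2_norm d (\<lambda>i. s i + core Q y i))\<^sup>2))) \<partial>D)
    \<le> ennreal (exp (9 * real d / Q\<^sup>2) * exp (sqrt (1 + (l2_norm d s)\<^sup>2)))"
proof -
  define p where "p = sqrt (1 + (l2_norm d s)\<^sup>2)"
  \<comment> \<open>The majorant carries the full centered sample in its linear term, so this term
    has mean 0. Where the sample was cut, the linear term is at most \<open>r / Q\<close>, hence at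
    most \<open>2 * r\<^sup>2 / Q\<^sup>2\<close>, in absolute value; together with the
    \<open>5 / 2\<close> of \<open>exp_sqrt_norm_step\<close> this gives
    \<open>9 / 2\<close>.\<close>
  define H where "H = (\<lambda>y. exp p * (1 + (\<Sum>i<d. s i / p / Q * (y i - \<mu> i)) + 9 / (2 * Q\<^sup>2) * (l2_dist d y \<mu>)\<^sup>2))"
  have p: "p \<ge> 1" by (simp add: p_def)
  have pw: "exp (sqrt (1 + (l2_norm d (\<lambda>i. s i + core Q y i))\<^sup>2)) \<le> H y" for y
  proof -
    define r where "r = l2_dist d y \<mu>"
    have r: "r \<ge> 0" by (simp add: r_def l2_dist_def)
    have nc: "l2_norm d (core Q y) = (if r \<le> Q / 2 then r / Q else 0)"
    proof (cases "r \<le> Q / 2")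
      case True
      then have "core Q y = (\<lambda>i. (1 / Q) * (y i - \<mu> i))" by (auto simp: core_def r_def)
      then show ?thesis
        using True Q by (simp only: l2_norm_scale) (simp add: r_def l2_dist_def)
    next
      case False
      then have "core Q y = (\<lambda>i. 0)" by (auto simp: core_def r_def)
      then show ?thesis using False by (simp add: l2_norm_def L2_set_def)
    qed
    have "(\<Sum>i<d. s i / p * core Q y i) \<le> (\<Sum>i<d. s i / p / Q * (y i - \<mu> i)) + 2 * r\<^sup>2 / Q\<^sup>2"
    proof (cases "r \<le> Q / 2")
      case True
      then show ?thesis by (simp add: core_def r_def)
    next
      case False
      have "l2_norm d (\<lambda>i. s i / p / Q) = l2_norm d s / p / Q"
        using l2_norm_scale[of d "1 / (p * Q)" s] p Q by simp
      also have "\<dots> \<le> 1 / Q"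
        using Q unfolding p_def by (intro divide_right_mono l2_norm_div_sqrt_le_1) simp
      finally have "l2_norm d (\<lambda>i. s i / p / Q) * r \<le> 1 / Q * r" using r by (rule mult_right_mono)
      then have "\<bar>\<Sum>i<d. s i / p / Q * (y i - \<mu> i)\<bar> \<le> r / Q"
        using l2_norm_inner[of "\<lambda>i. s i / p / Q" "\<lambda>i. y i - \<mu> i" d] by (simp add: r_def l2_dist_def)
      moreover have "r / Q \<le> 2 * r\<^sup>2 / Q\<^sup>2"
        using False Q r mult_right_mono[of "Q / 2" r "2 * r"] by (simp add: field_simps power2_eq_square)
      moreover have "(\<Sum>i<d. s i / p * core Q y i) = 0" using False by (simp add: core_def r_def)
      ultimately show ?thesis by linarith
    qed
    moreover have "5 / 2 * (l2_norm d (core Q y))\<^sup>2 \<le> 5 / 2 * (r\<^sup>2 / Q\<^sup>2)"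
      by (simp add: nc power_divide)
    ultimately have "1 + (\<Sum>i<d. s i / p * core Q y i) + 5 / 2 * (l2_norm d (core Q y))\<^sup>2
        \<le> 1 + (\<Sum>i<d. s i / p / Q * (y i - \<mu> i)) + (2 * r\<^sup>2 / Q\<^sup>2 + 5 / 2 * (r\<^sup>2 / Q\<^sup>2))" by linarith
    also have "2 * r\<^sup>2 / Q\<^sup>2 + 5 / 2 * (r\<^sup>2 / Q\<^sup>2) = 9 / (2 * Q\<^sup>2) * r\<^sup>2" using Q by (simp add: field_simps)
    finally have "exp p * (1 + (\<Sum>i<d. s i / p * core Q y i) + 5 / 2 * (l2_norm d (core Q y))\<^sup>2) \<le> H y"
      unfolding H_def r_def by simp
    moreover have "l2_norm d (core Q y) \<le> 1 / 2" using Q r by (simp add: nc field_simps)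
    ultimately show ?thesis
      using exp_sqrt_norm_step[of d "core Q y" s] unfolding p_def by linarith
  qed
  then have H0: "H y \<ge> 0" for y by (meson exp_ge_zero order_trans)
  note int = inner_mean(1)[of "\<lambda>i. s i / p / Q"] dist_square(1)
  have iH: "integrable D H"
    unfolding H_def using int by (intro integrable_mult_right integrable_add integrable_const) auto
  have "(\<integral>y. H y \<partial>D) = exp p * (1 + 9 / (2 * Q\<^sup>2) * (\<integral>y. (l2_dist d y \<mu>)\<^sup>2 \<partial>D))"
    unfolding H_def using int inner_mean(2)[of "\<lambda>i. s i / p / Q"] by (simp add: prob_space)
  also have "\<dots> \<le> exp p * (1 + 9 / (2 * Q\<^sup>2) * (2 * real d))"
    using dist_square(2) by (intro mult_left_mono add_left_mono) auto
  also have "\<dots> \<le> exp p * exp (9 * real d / Q\<^sup>2)"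
    using exp_ge_add_one_self[of "9 * real d / Q\<^sup>2"] by (intro mult_left_mono) (auto simp: field_simps)
  finally have "ennreal (\<integral>y. H y \<partial>D) \<le> ennreal (exp (9 * real d / Q\<^sup>2) * exp p)"
    by (intro ennreal_leI) (simp add: mult.commute)
  moreover have "(\<integral>\<^sup>+y. ennreal (exp (sqrt (1 + (l2_norm d (\<lambda>i. s i + core Q y i))\<^sup>2))) \<partial>D) \<le> (\<integral>\<^sup>+y. ennreal (H y) \<partial>D)"
    using pw by (intro nn_integral_mono ennreal_leI)
  ultimately show ?thesis
    unfolding nn_integral_eq_integral[OF iH AE_I2[OF H0]] p_def by (rule order_trans[rotated])
qed

text \<open>The walk starts at the origin, where the potential is \<open>exp 1\<close>, and each of
  the \<open>m\<close> samples contributes the factor of \<open>core_step\<close>.\<close>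

lemma core_sum:
  assumes Q: "Q > 0"
  shows "(\<integral>\<^sup>+x. ennreal (exp (sqrt (1 + (l2_norm d (\<lambda>i. \<Sum>b<m. core Q (x b) i))\<^sup>2))) \<partial>Pi\<^sub>M {..<m} (\<lambda>_. D))
    \<le> ennreal (exp (1 + real m * (9 * real d / Q\<^sup>2)))"
proof -
  define U where "U = (\<lambda>j s. ennreal (exp (real j * (9 * real d / Q\<^sup>2)) * exp (sqrt (1 + (l2_norm d s)\<^sup>2))))"
  have "(\<integral>\<^sup>+x. U 0 (\<lambda>i. (\<lambda>_. 0) i + (\<Sum>b\<in>{..<m}. core Q (x b) i)) \<partial>Pi\<^sub>M {..<m} (\<lambda>_. D))
      \<le> U (0 + card {..<m}) (\<lambda>_. 0)"
  proof (rule nn_integral_PiM_sum_le[OF prob_space_axioms])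
    fix J :: "nat set" and j and s :: vec
    assume "finite J"
    have [measurable]: "(\<lambda>x. l2_norm d (\<lambda>i. s i + (\<Sum>b\<in>J. core Q (x b) i))) \<in> borel_measurable (Pi\<^sub>M J (\<lambda>_. D))"
      by (intro borel_measurable_l2_norm borel_measurable_add borel_measurable_sum
            measurable_PiM_apply[OF _ core_measurable]) auto
    show "(\<lambda>x. U j (\<lambda>i. s i + (\<Sum>b\<in>J. core Q (x b) i))) \<in> borel_measurable (Pi\<^sub>M J (\<lambda>_. D))"
      unfolding U_def by measurable
  next
    fix j and s :: vec
    have [measurable]: "(\<lambda>y. l2_norm d (\<lambda>i. s i + core Q y i)) \<in> borel_measurable D"
      by (intro borel_measurable_l2_norm borel_measurable_add core_measurable) auto
    have "(\<integral>\<^sup>+y. U j (\<lambda>i. s i + core Q y i) \<partial>D)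
      = ennreal (exp (real j * (9 * real d / Q\<^sup>2))) * (\<integral>\<^sup>+y. ennreal (exp (sqrt (1 + (l2_norm d (\<lambda>i. s i + core Q y i))\<^sup>2))) \<partial>D)"
      unfolding U_def by (subst nn_integral_cmult[symmetric]) (auto simp: ennreal_mult)
    also have "\<dots> \<le> ennreal (exp (real j * (9 * real d / Q\<^sup>2))) * ennreal (exp (9 * real d / Q\<^sup>2) * exp (sqrt (1 + (l2_norm d s)\<^sup>2)))"
      by (intro mult_left_mono core_step Q) auto
    also have "\<dots> = U (Suc j) s"
      unfolding U_def by (simp add: ennreal_mult[symmetric] exp_add[symmetric] algebra_simps add_divide_distrib)
    finally show "(\<integral>\<^sup>+y. U j (\<lambda>i. s i + core Q y i) \<partial>D) \<le> U (Suc j) s" .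
  qed simp
  then show ?thesis
    by (simp add: U_def l2_norm_def L2_set_def exp_add[symmetric] add.commute)
qed

section \<open>Second moments of sums of centered samples\<close>

lemma dist_add_step:
  "(\<integral>\<^sup>+y. ennreal ((l2_norm d (\<lambda>i. s i + (y i - \<mu> i)))\<^sup>2 + a) \<partial>D)
    \<le> ennreal ((l2_norm d s)\<^sup>2 + (2 * real d + a))" if a: "a \<ge> 0"
proof -
  let ?H = "\<lambda>y. (l2_norm d s)\<^sup>2 + 2 * (\<Sum>i<d. s i * (y i - \<mu> i)) + (l2_dist d y \<mu>)\<^sup>2 + a"
  have eq: "(l2_norm d (\<lambda>i. s i + (y i - \<mu> i)))\<^sup>2 + a = ?H y" for y
    by (simp add: l2_norm_add_power2 l2_dist_def)
  have iH: "integrable D ?H"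
    using inner_mean(1)[of s] dist_square(1) by auto
  have "(\<integral>\<^sup>+y. ennreal (?H y) \<partial>D) = ennreal (\<integral>y. ?H y \<partial>D)"
    using a by (intro nn_integral_eq_integral iH) (auto simp: eq[symmetric])
  also have "(\<integral>y. ?H y \<partial>D) = (l2_norm d s)\<^sup>2 + (\<integral>y. (l2_dist d y \<mu>)\<^sup>2 \<partial>D) + a"
    using inner_mean[of s] dist_square(1) by (simp add: prob_space)
  also have "\<dots> \<le> (l2_norm d s)\<^sup>2 + (2 * real d + a)"
    using dist_square(2) by simp
  finally show ?thesis unfolding eq by (simp add: ennreal_leI)
qed

lemma sample_component:
  "b \<in> J \<Longrightarrow> i < d \<Longrightarrow> (\<lambda>x. x b i) \<in> borel_measurable (Pi\<^sub>M J (\<lambda>_. D))"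
  by (rule measurable_PiM_apply[OF _ component])

text \<open>Cross terms vanish in mean, so each sample adds at most \<open>2 * real d\<close>. The
  start \<open>s\<close> and the offset \<open>a\<close> are arbitrary because one person serves as
  a single step of the walk over all people in \<open>dataset_sum_square\<close>.\<close>

lemma person_sum_step:
  assumes a: "a \<ge> 0"
  shows "(\<integral>\<^sup>+x. ennreal ((l2_norm d (\<lambda>i. s i + (\<Sum>b<m. x b i - \<mu> i)))\<^sup>2 + a) \<partial>Pi\<^sub>M {..<m} (\<lambda>_. D))
    \<le> ennreal ((l2_norm d s)\<^sup>2 + (real m * (2 * real d) + a))"
proof -
  define U where "U = (\<lambda>j s. ennreal ((l2_norm d s)\<^sup>2 + (real j * (2 * real d) + a)))"
  have "(\<integral>\<^sup>+x. U 0 (\<lambda>i. s i + (\<Sum>b\<in>{..<m}. (\<lambda>y i. y i - \<mu> i) (x b) i)) \<partial>Pi\<^sub>M {..<m} (\<lambda>_. D))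
      \<le> U (0 + card {..<m}) s"
  proof (rule nn_integral_PiM_sum_le[OF prob_space_axioms])
    fix J :: "nat set" and j and s :: vec
    assume "finite J"
    have [measurable]: "(\<lambda>x. l2_norm d (\<lambda>i. s i + (\<Sum>b\<in>J. x b i - \<mu> i))) \<in> borel_measurable (Pi\<^sub>M J (\<lambda>_. D))"
      by (intro borel_measurable_l2_norm borel_measurable_add borel_measurable_sum borel_measurable_diff
            sample_component) auto
    show "(\<lambda>x. U j (\<lambda>i. s i + (\<Sum>b\<in>J. x b i - \<mu> i))) \<in> borel_measurable (Pi\<^sub>M J (\<lambda>_. D))"
      unfolding U_def by measurable
  next
    fix j and s :: vec
    show "(\<integral>\<^sup>+y. U j (\<lambda>i. s i + (y i - \<mu> i)) \<partial>D) \<le> U (Suc j) s"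
      unfolding U_def using dist_add_step[of "real j * (2 * real d) + a" s] a by (simp add: algebra_simps)
  qed simp
  then show ?thesis by (simp add: U_def)
qed

lemma prob_space_person: "prob_space (Pi\<^sub>M {..<m} (\<lambda>_. D))"
  by (intro prob_space_PiM prob_space_axioms)

lemma dataset_component:
  "a \<in> J \<Longrightarrow> b < m \<Longrightarrow> i < d \<Longrightarrow> (\<lambda>X. X a b i) \<in> borel_measurable (Pi\<^sub>M J (\<lambda>_. Pi\<^sub>M {..<m} (\<lambda>_. D)))"
  by (rule measurable_PiM_apply[OF _ sample_component]) auto

lemma dataset_sum_square:
  "(\<integral>\<^sup>+X. ennreal ((l2_norm d (\<lambda>i. \<Sum>a<n. \<Sum>b<m. X a b i - \<mu> i))\<^sup>2) \<partial>iid_dataset n m D)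
    \<le> ennreal (real n * (real m * (2 * real d)))"
proof -
  define U where "U = (\<lambda>j s. ennreal ((l2_norm d s)\<^sup>2 + real j * (real m * (2 * real d))))"
  have "(\<integral>\<^sup>+X. U 0 (\<lambda>i. (\<lambda>_. 0) i + (\<Sum>a\<in>{..<n}. (\<lambda>x i. \<Sum>b<m. x b i - \<mu> i) (X a) i))
        \<partial>Pi\<^sub>M {..<n} (\<lambda>_. Pi\<^sub>M {..<m} (\<lambda>_. D))) \<le> U (0 + card {..<n}) (\<lambda>_. 0)"
  proof (rule nn_integral_PiM_sum_le[OF prob_space_person])
    fix J :: "nat set" and j and s :: vec
    assume "finite J"
    have [measurable]: "(\<lambda>X. l2_norm d (\<lambda>i. s i + (\<Sum>a\<in>J. \<Sum>b<m. X a b i - \<mu> i)))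
        \<in> borel_measurable (Pi\<^sub>M J (\<lambda>_. Pi\<^sub>M {..<m} (\<lambda>_. D)))"
      by (intro borel_measurable_l2_norm borel_measurable_add borel_measurable_sum borel_measurable_diff
            dataset_component) auto
    show "(\<lambda>X. U j (\<lambda>i. s i + (\<Sum>a\<in>J. \<Sum>b<m. X a b i - \<mu> i)))
        \<in> borel_measurable (Pi\<^sub>M J (\<lambda>_. Pi\<^sub>M {..<m} (\<lambda>_. D)))"
      unfolding U_def by measurable
  next
    fix j and s :: vec
    show "(\<integral>\<^sup>+x. U j (\<lambda>i. s i + (\<Sum>b<m. x b i - \<mu> i)) \<partial>Pi\<^sub>M {..<m} (\<lambda>_. D)) \<le> U (Suc j) s"
      unfolding U_def using person_sum_step[of "real j * (real m * (2 * real d))" m s] by (simp add: algebra_simps)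
  qed simp
  then show ?thesis by (simp add: U_def iid_dataset_def l2_norm_def L2_set_def)
qed

section \<open>Accuracy of clip-and-noise\<close>

text \<open>Each centered sample is \<open>Q\<close> times its core plus a part that vanishes unless
  the sample is far from the mean. Averaging over \<open>m\<close> samples turns
  \<open>Q = m * g\<close> into the unit \<open>g\<close> in front of the core sum.\<close>

lemma sample_average_decomposition:
  assumes m: "m > 0" and g: "g > 0"
  defines "Q \<equiv> real m * g"
  shows "l2_dist d (person_average d m x) \<mu>
    \<le> g * l2_norm d (\<lambda>i. \<Sum>b<m. core Q (x b) i)
      + (\<Sum>b<m. if l2_dist d (x b) \<mu> > Q / 2 then l2_dist d (x b) \<mu> else 0) / real m"
proof -
  define far where "far = (\<lambda>(y :: vec) i. if l2_dist d y \<mu> > Q / 2 then y i - \<mu> i else 0)"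
  have Q: "Q > 0" using m g by (simp add: Q_def)
  have split: "y i - \<mu> i = Q * core Q y i + far y i" for y i
    using Q by (simp add: core_def far_def)
  have "l2_dist d (person_average d m x) \<mu>
      = l2_norm d (\<lambda>i. g * (\<Sum>b<m. core Q (x b) i) + 1 / real m * (\<Sum>b<m. far (x b) i))"
    unfolding l2_dist_def
  proof (rule l2_norm_cong)
    fix i assume i: "i < d"
    have "person_average d m x i - \<mu> i = (\<Sum>b<m. x b i - \<mu> i) / real m"
      using m i by (simp add: person_average_def sum_subtractf diff_divide_distrib)
    also have "\<dots> = (Q * (\<Sum>b<m. core Q (x b) i) + (\<Sum>b<m. far (x b) i)) / real m"
      by (simp only: split sum.distrib sum_distrib_left)
    finally show "person_average d m x i - \<mu> i
        = g * (\<Sum>b<m. core Q (x b) i) + 1 / real m * (\<Sum>b<m. far (x b) i)"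
      using m by (simp add: Q_def add_divide_distrib)
  qed
  also have "\<dots> \<le> l2_norm d (\<lambda>i. g * (\<Sum>b<m. core Q (x b) i)) + l2_norm d (\<lambda>i. 1 / real m * (\<Sum>b<m. far (x b) i))"
    by (rule l2_norm_triangle)
  also have "\<dots> = g * l2_norm d (\<lambda>i. \<Sum>b<m. core Q (x b) i) + l2_norm d (\<lambda>i. \<Sum>b<m. far (x b) i) / real m"
    using g by (simp only: l2_norm_scale) simp
  also have "l2_norm d (\<lambda>i. \<Sum>b<m. far (x b) i) \<le> (\<Sum>b<m. l2_norm d (far (x b)))"
    by (rule l2_norm_sum[of d "\<lambda>b. far (x b)" "{..<m}"])
  also have "(\<Sum>b<m. l2_norm d (far (x b))) = (\<Sum>b<m. if l2_dist d (x b) \<mu> > Q / 2 then l2_dist d (x b) \<mu> else 0)"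
  proof (rule sum.cong)
    fix b
    have "far (x b) = (if l2_dist d (x b) \<mu> > Q / 2 then (\<lambda>i. x b i - \<mu> i) else (\<lambda>i. 0))"
      by (auto simp: far_def)
    then show "l2_norm d (far (x b)) = (if l2_dist d (x b) \<mu> > Q / 2 then l2_dist d (x b) \<mu> else 0)"
      by (simp add: l2_dist_def) (simp add: l2_norm_def L2_set_def)
  qed simp
  finally show ?thesis by (simp add: divide_right_mono)
qed

text \<open>The part \<open>R\<close> of the radius absorbs the error of the coarse estimate. The
  remaining \<open>g * T\<close> is compared with the core sum, whose overshoot is exponentially
  rare; far samples are paid for in mean by \<open>tail_bound\<close>.\<close>

lemma person_excess:
  assumes d: "d > 0" and m: "m > 0" and g: "g \<ge> sqrt (real d / real m)"
    and c: "l2_dist d c \<mu> \<le> R" and \<rho>: "\<rho> = R + g * T"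
  shows "(\<integral>\<^sup>+x. ennreal (max 0 (l2_dist d (person_average d m x) c - \<rho>)) \<partial>Pi\<^sub>M {..<m} (\<lambda>_. D))
    \<le> ennreal (sqrt d * (real m * g / (4 * sqrt d)) powr (1 - k) + g * exp (10 - T))"
proof -
  define Q where "Q = real m * g"
  define \<beta> where "\<beta> = Q / (4 * sqrt d)"
  let ?far = "\<lambda>y. if l2_dist d y \<mu> > Q / 2 then l2_dist d y \<mu> else 0"
  let ?N = "\<lambda>x. l2_norm d (\<lambda>i. \<Sum>b<m. core Q (x b) i)"
  let ?P = "Pi\<^sub>M {..<m} (\<lambda>_. D)"
  have g0: "g > 0" using d m by (intro less_le_trans[OF _ g]) simp
  have Q: "Q > 0" using m g0 by (simp add: Q_def)
  have \<beta>: "\<beta> > 0" "2 * sqrt d * \<beta> = Q / 2" using Q d by (simp_all add: \<beta>_def)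
  have pw: "max 0 (l2_dist d (person_average d m x) c - \<rho>)
      \<le> (\<Sum>b<m. ?far (x b)) / real m + g * exp (- T) * exp (sqrt (1 + (?N x)\<^sup>2))" for x
  proof -
    have "l2_dist d (person_average d m x) c \<le> l2_dist d (person_average d m x) \<mu> + R"
      using l2_dist_triangle[of d "person_average d m x" c \<mu>] c by (simp add: l2_dist_commute[of d \<mu> c])
    then have "l2_dist d (person_average d m x) c - \<rho> \<le> (\<Sum>b<m. ?far (x b)) / real m + g * (?N x - T)"
      using sample_average_decomposition[OF m g0, of x] unfolding \<rho> Q_def[symmetric]
      by (simp add: algebra_simps)
    also have "g * (?N x - T) \<le> g * exp (- T) * exp (sqrt (1 + (?N x)\<^sup>2))"
    proof -
      \<comment> \<open>The overshoot beyond \<open>T\<close> is bounded by an exponential, so that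
        the moment from \<open>core_sum\<close> controls its mean with the gain
        \<open>exp (- T)\<close>.\<close>
      have "?N x - T \<le> exp (?N x - T)" using exp_ge_add_one_self[of "?N x - T"] by linarith
      also have "\<dots> \<le> exp (sqrt (1 + (?N x)\<^sup>2) - T)"
        by (simp add: real_le_rsqrt)
      also have "\<dots> = exp (- T) * exp (sqrt (1 + (?N x)\<^sup>2))" by (simp add: exp_add[symmetric])
      finally show ?thesis using g0 by simp
    qed
    finally have *: "l2_dist d (person_average d m x) c - \<rho>
        \<le> (\<Sum>b<m. ?far (x b)) / real m + g * exp (- T) * exp (sqrt (1 + (?N x)\<^sup>2))" by simp
    have "0 \<le> (\<Sum>b<m. ?far (x b)) / real m + g * exp (- T) * exp (sqrt (1 + (?N x)\<^sup>2))"
      using g0 by (intro add_nonneg_nonneg divide_nonneg_nonneg sum_nonneg mult_nonneg_nonneg)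
        (auto simp: l2_dist_def)
    then show ?thesis using * by simp
  qed
  have far_nn: "?far y \<ge> 0" for y by (simp add: l2_dist_def)
  have [measurable]: "(\<lambda>x. ?far (x b)) \<in> borel_measurable ?P" if "b < m" for b
  proof -
    have "?far \<in> borel_measurable D" by measurable
    then show ?thesis using that
      by (intro measurable_PiM_apply[where f = ?far]) auto
  qed
  have [measurable]: "?N \<in> borel_measurable ?P"
    by (intro borel_measurable_l2_norm borel_measurable_sum measurable_PiM_apply core_measurable)
  have far_int: "(\<integral>\<^sup>+x. ennreal (?far (x b)) \<partial>?P) \<le> ennreal (sqrt d * \<beta> powr (1 - k))" if "b < m" for b
  proof -
    have "(\<integral>\<^sup>+x. ennreal (?far (x b)) \<partial>?P) = (\<integral>\<^sup>+y. ennreal (?far y) \<partial>D)"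
      using that by (intro nn_integral_PiM_component[where f = "\<lambda>y. ennreal (?far y)"]) (auto intro: prob_space_axioms)
    then show ?thesis using tail_bound[OF d \<beta>(1)] unfolding \<beta>(2) by simp
  qed
  have "(\<integral>\<^sup>+x. ennreal (max 0 (l2_dist d (person_average d m x) c - \<rho>)) \<partial>?P)
      \<le> (\<integral>\<^sup>+x. ennreal (1 / real m) * (\<Sum>b<m. ennreal (?far (x b)))
          + ennreal (g * exp (- T)) * ennreal (exp (sqrt (1 + (?N x)\<^sup>2))) \<partial>?P)"
  proof (rule nn_integral_mono)
    fix x
    have "ennreal (1 / real m) * (\<Sum>b<m. ennreal (?far (x b)))
          + ennreal (g * exp (- T)) * ennreal (exp (sqrt (1 + (?N x)\<^sup>2)))
        = ennreal ((\<Sum>b<m. ?far (x b)) / real m + g * exp (- T) * exp (sqrt (1 + (?N x)\<^sup>2)))"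
      using g0 far_nn by (simp only: sum_ennreal) (simp add: ennreal_mult[symmetric] sum_nonneg flip: ennreal_plus)
    then show "ennreal (max 0 (l2_dist d (person_average d m x) c - \<rho>))
        \<le> ennreal (1 / real m) * (\<Sum>b<m. ennreal (?far (x b)))
          + ennreal (g * exp (- T)) * ennreal (exp (sqrt (1 + (?N x)\<^sup>2)))"
      using ennreal_leI[OF pw[of x]] by (simp only:)
  qed
  also have "\<dots> = ennreal (1 / real m) * (\<Sum>b<m. \<integral>\<^sup>+x. ennreal (?far (x b)) \<partial>?P)
      + ennreal (g * exp (- T)) * (\<integral>\<^sup>+x. ennreal (exp (sqrt (1 + (?N x)\<^sup>2))) \<partial>?P)"
  proof -
    have [measurable]: "(\<lambda>x. \<Sum>b<m. ennreal (?far (x b))) \<in> borel_measurable ?P"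
      by (intro borel_measurable_sum) auto
    show ?thesis
      by (subst nn_integral_add) (auto simp: nn_integral_cmult nn_integral_sum)
  qed
  also have "\<dots> \<le> ennreal (1 / real m) * (\<Sum>b<m. ennreal (sqrt d * \<beta> powr (1 - k)))
      + ennreal (g * exp (- T)) * ennreal (exp 10)"
  proof (intro add_mono mult_left_mono sum_mono)
    \<comment> \<open>The lower bound on \<open>g\<close> keeps the growth over all \<open>m\<close>
      samples bounded: the exponent in \<open>core_sum\<close> is at most \<open>1 + 9\<close>,
      whence the 10 in the conclusion.\<close>
    have "real d / real m \<le> g\<^sup>2"
      using g g0 by (simp add: real_sqrt_le_iff' sqrt_le_D)
    then have "real m * (9 * real d / Q\<^sup>2) \<le> 9"
      using m g0 by (simp add: Q_def field_simps power2_eq_square)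
    then have "exp (1 + real m * (9 * real d / Q\<^sup>2)) \<le> exp 10" by simp
    then show "(\<integral>\<^sup>+x. ennreal (exp (sqrt (1 + (?N x)\<^sup>2))) \<partial>?P) \<le> ennreal (exp 10)"
      using core_sum[OF Q, of m] by (meson ennreal_leI order_trans)
  qed (use far_int in auto)
  also have "\<dots> = ennreal (sqrt d * \<beta> powr (1 - k) + g * exp (10 - T))"
  proof -
    have "(\<Sum>b<m. ennreal (sqrt d * \<beta> powr (1 - k))) = ennreal (real m * (sqrt d * \<beta> powr (1 - k)))"
      by (subst sum_ennreal) auto
    moreover have "exp (10 - T) = exp (- T) * exp 10" by (simp add: exp_add[symmetric])
    ultimately show ?thesis
      using m g0 by (simp add: ennreal_mult[symmetric] mult.assoc flip: ennreal_plus)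
  qed
  finally show ?thesis by (simp add: \<beta>_def Q_def)
qed

section \<open>Measurability of the mechanism and its mean error\<close>

lemma prob_space_iid_dataset: "prob_space (iid_dataset n m D)"
  unfolding iid_dataset_def by (intro prob_space_PiM prob_space_axioms)

lemma person_average_measurable:
  "i < d \<Longrightarrow> (\<lambda>x. person_average d m x i) \<in> borel_measurable (Pi\<^sub>M {..<m} (\<lambda>_. D))"
  by (simp add: person_average_def sample_component)

lemma excess_measurable:
  "(\<lambda>x. max 0 (l2_dist d (person_average d m x) c - \<rho>)) \<in> borel_measurable (Pi\<^sub>M {..<m} (\<lambda>_. D))"
  unfolding l2_dist_def
  by (intro borel_measurable_max borel_measurable_const borel_measurable_diff borel_measurable_l2_norm
      person_average_measurable)

lemma clipped_person_measurable:
  assumes i: "i < d"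
  shows "(\<lambda>x. ball_projection d c \<rho> (person_average d m x) i) \<in> borel_measurable (Pi\<^sub>M {..<m} (\<lambda>_. D))"
proof -
  note [measurable] = person_average_measurable[OF i]
  have [measurable]: "(\<lambda>x. l2_dist d (person_average d m x) c) \<in> borel_measurable (Pi\<^sub>M {..<m} (\<lambda>_. D))"
    unfolding l2_dist_def
    by (intro borel_measurable_diff borel_measurable_const borel_measurable_l2_norm person_average_measurable)
  have eq: "ball_projection d c \<rho> (person_average d m x) i =
      (if l2_dist d (person_average d m x) c \<le> \<rho> then person_average d m x i
       else c i + \<rho> / l2_dist d (person_average d m x) c * (person_average d m x i - c i))" for x
    using i by (simp add: ball_projection_def)
  show ?thesis unfolding eq by measurable
qed

lemma clipped_mean_measurable:
  assumes "i < d"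
  shows "(\<lambda>X. clipped_mean d n m \<rho> c X i) \<in> borel_measurable (iid_dataset n m D)"
  unfolding clipped_mean_def iid_dataset_def
  by (intro borel_measurable_divide borel_measurable_sum borel_measurable_const
      measurable_PiM_apply[OF _ clipped_person_measurable[OF assms]])

text \<open>Joint measurability in the dataset and the noise makes the mechanism a kernel. The bind
  over a random dataset is then a genuine mixture, and expectations under it can be
  iterated.\<close>

lemma clip_and_noise_kernel:
  assumes \<sigma>: "\<sigma> > 0"
  shows "clip_and_noise d n m \<rho> \<sigma> c \<in> iid_dataset n m D \<rightarrow>\<^sub>M subprob_algebra (Rd d)"
proof -
  let ?M = "iid_dataset n m D" and ?G = "gaussian_noise d \<sigma>"
  interpret G: prob_space ?G unfolding gaussian_noise_eq by (rule prob_space_gauss_vec[OF \<sigma>])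
  have comp: "(\<lambda>z. z i) \<in> borel_measurable ?G" if "i < d" for i
    using that unfolding gaussian_noise_eq by (intro measurable_Rd_component) auto
  have joint: "(\<lambda>(X, z). \<lambda>i\<in>{..<d}. clipped_mean d n m \<rho> c X i + z i) \<in> ?M \<Otimes>\<^sub>M ?G \<rightarrow>\<^sub>M Rd d"
    unfolding Rd_def split_beta
  proof (rule measurable_restrict)
    fix i assume "i \<in> {..<d}"
    then have [measurable]: "(\<lambda>X. clipped_mean d n m \<rho> c X i) \<in> borel_measurable ?M"
      "(\<lambda>z. z i) \<in> borel_measurable ?G"
      by (auto intro: clipped_mean_measurable comp)
    show "(\<lambda>p. clipped_mean d n m \<rho> c (fst p) i + snd p i) \<in> borel_measurable (?M \<Otimes>\<^sub>M ?G)"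
      by (intro borel_measurable_add measurable_compose[OF measurable_fst] measurable_compose[OF measurable_snd])
         (measurable)
  qed
  have "(\<lambda>X. distr ?G (Rd d) (\<lambda>z. \<lambda>i\<in>{..<d}. clipped_mean d n m \<rho> c X i + z i)) \<in> ?M \<rightarrow>\<^sub>M subprob_algebra (Rd d)"
    by (rule measurable_distr2[OF joint]) (auto simp: space_subprob_algebra G.subprob_space_axioms)
  then show ?thesis
    unfolding clip_and_noise_def clipped_mean_def by simp
qed

text \<open>A pointwise split into the deviation of the overall sample average and the mean
  displacement by the projections. The first part never sees the clipping, so independence across
  people can be used for it.\<close>

lemma clipped_mean_error:
  assumes n: "n > 0" and m: "m > 0" and \<rho>: "\<rho> \<ge> 0"
  shows "l2_dist d (clipped_mean d n m \<rho> c X) \<mu>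
    \<le> l2_norm d (\<lambda>i. \<Sum>a<n. \<Sum>b<m. X a b i - \<mu> i) / (real n * real m)
      + (\<Sum>a<n. max 0 (l2_dist d (person_average d m (X a)) c - \<rho>)) / real n"
proof -
  let ?A = "\<lambda>a. person_average d m (X a)"
  let ?P = "\<lambda>a. ball_projection d c \<rho> (?A a)"
  have "l2_dist d (clipped_mean d n m \<rho> c X) \<mu>
      = l2_norm d (\<lambda>i. 1 / (real n * real m) * (\<Sum>a<n. \<Sum>b<m. X a b i - \<mu> i) + 1 / real n * (\<Sum>a<n. ?P a i - ?A a i))"
    unfolding l2_dist_def
  proof (rule l2_norm_cong)
    fix i assume i: "i < d"
    have "(\<Sum>b<m. X a b i - \<mu> i) = real m * (?A a i - \<mu> i)" for a
      using m i by (simp add: person_average_def sum_subtractf algebra_simps)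
    then have "1 / (real n * real m) * (\<Sum>a<n. \<Sum>b<m. X a b i - \<mu> i) = (\<Sum>a<n. ?A a i - \<mu> i) / real n"
      using m by (simp add: sum_distrib_left[symmetric])
    then have "1 / (real n * real m) * (\<Sum>a<n. \<Sum>b<m. X a b i - \<mu> i) + 1 / real n * (\<Sum>a<n. ?P a i - ?A a i)
        = (\<Sum>a<n. ?P a i - \<mu> i) / real n"
      by (simp add: sum_subtractf diff_divide_distrib)
    then show "clipped_mean d n m \<rho> c X i - \<mu> i
        = 1 / (real n * real m) * (\<Sum>a<n. \<Sum>b<m. X a b i - \<mu> i) + 1 / real n * (\<Sum>a<n. ?P a i - ?A a i)"
      using n by (simp add: clipped_mean_def sum_subtractf diff_divide_distrib)
  qed
  also have "\<dots> \<le> l2_norm d (\<lambda>i. 1 / (real n * real m) * (\<Sum>a<n. \<Sum>b<m. X a b i - \<mu> i))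
      + l2_norm d (\<lambda>i. 1 / real n * (\<Sum>a<n. ?P a i - ?A a i))"
    by (rule l2_norm_triangle)
  also have "\<dots> = l2_norm d (\<lambda>i. \<Sum>a<n. \<Sum>b<m. X a b i - \<mu> i) / (real n * real m)
      + l2_norm d (\<lambda>i. \<Sum>a<n. ?P a i - ?A a i) / real n"
    by (simp only: l2_norm_scale) simp
  finally have main: "l2_dist d (clipped_mean d n m \<rho> c X) \<mu>
      \<le> l2_norm d (\<lambda>i. \<Sum>a<n. \<Sum>b<m. X a b i - \<mu> i) / (real n * real m)
      + l2_norm d (\<lambda>i. \<Sum>a<n. ?P a i - ?A a i) / real n" .
  have "l2_norm d (\<lambda>i. \<Sum>a<n. ?P a i - ?A a i) \<le> (\<Sum>a<n. l2_dist d (?P a) (?A a))"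
    unfolding l2_dist_def by (rule l2_norm_sum[of d "\<lambda>a i. ?P a i - ?A a i" "{..<n}"])
  also have "\<dots> \<le> (\<Sum>a<n. max 0 (l2_dist d (?A a) c - \<rho>))"
    by (intro sum_mono l2_dist_ball_projection \<rho>)
  finally have "l2_norm d (\<lambda>i. \<Sum>a<n. ?P a i - ?A a i) / real n
      \<le> (\<Sum>a<n. max 0 (l2_dist d (?A a) c - \<rho>)) / real n"
    by (rule divide_right_mono) simp
  then show ?thesis using main by linarith
qed

text \<open>\<open>dataset_sum_square\<close> bounds the mean square of the first part by
  \<open>2 * d / (n * m)\<close>. The people are identically distributed, so the average excess has
  the mean bound \<open>e\<close> of a single person.\<close>

lemma expected_clipped_mean_error:
  assumes n: "n > 0" and m: "m > 0" and \<rho>: "\<rho> \<ge> 0" and \<tau>: "\<tau> > 0" "e \<ge> 0"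
    and var: "2 * real d / (real n * real m) \<le> \<tau>\<^sup>2"
    and excess: "(\<integral>\<^sup>+x. ennreal (max 0 (l2_dist d (person_average d m x) c - \<rho>)) \<partial>Pi\<^sub>M {..<m} (\<lambda>_. D)) \<le> ennreal e"
  shows "(\<integral>\<^sup>+X. ennreal (l2_dist d (clipped_mean d n m \<rho> c X) \<mu>) \<partial>iid_dataset n m D) \<le> ennreal (2 * \<tau> + e)"
proof -
  let ?M = "iid_dataset n m D"
  let ?S = "\<lambda>X. l2_norm d (\<lambda>i. \<Sum>a<n. \<Sum>b<m. X a b i - \<mu> i)"
  let ?E = "\<lambda>x. max 0 (l2_dist d (person_average d m x) c - \<rho>)"
  interpret M: prob_space ?M by (rule prob_space_iid_dataset)
  have [measurable]: "?S \<in> borel_measurable ?M"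
    unfolding iid_dataset_def
    by (intro borel_measurable_l2_norm borel_measurable_sum borel_measurable_diff dataset_component) auto
  have E_meas: "(\<lambda>X. ennreal (?E (X a))) \<in> borel_measurable ?M" if "a < n" for a
    unfolding iid_dataset_def using that
    by (intro measurable_compose[OF measurable_PiM_apply[OF _ excess_measurable] measurable_ennreal]) simp
  have S: "(\<integral>\<^sup>+X. ennreal (?S X / (real n * real m)) \<partial>?M) \<le> ennreal (2 * \<tau>)"
  proof (rule M.nn_integral_le_of_square)
    have "(\<integral>\<^sup>+X. ennreal ((?S X / (real n * real m))\<^sup>2) \<partial>?M)
        = (\<integral>\<^sup>+X. ennreal (1 / (real n * real m)\<^sup>2) * ennreal ((?S X)\<^sup>2) \<partial>?M)"
      by (simp add: ennreal_mult[symmetric] power_divide)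
    also have "\<dots> = ennreal (1 / (real n * real m)\<^sup>2) * (\<integral>\<^sup>+X. ennreal ((?S X)\<^sup>2) \<partial>?M)"
      by (rule nn_integral_cmult) auto
    also have "\<dots> \<le> ennreal (1 / (real n * real m)\<^sup>2) * ennreal (real n * (real m * (2 * real d)))"
      by (intro mult_left_mono dataset_sum_square) auto
    also have "\<dots> = ennreal (2 * real d / (real n * real m))"
      using n m by (simp add: ennreal_mult[symmetric] power2_eq_square)
    also have "\<dots> \<le> ennreal (\<tau>\<^sup>2)" using var by (rule ennreal_leI)
    finally show "(\<integral>\<^sup>+X. ennreal ((?S X / (real n * real m))\<^sup>2) \<partial>?M) \<le> ennreal (\<tau>\<^sup>2)" .
  qed (use \<tau> in auto)
  have E: "(\<integral>\<^sup>+X. ennreal (?E (X a)) \<partial>?M) \<le> ennreal e" if "a < n" for a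
  proof -
    have "(\<integral>\<^sup>+X. ennreal (?E (X a)) \<partial>?M) = (\<integral>\<^sup>+x. ennreal (?E x) \<partial>Pi\<^sub>M {..<m} (\<lambda>_. D))"
      unfolding iid_dataset_def using that
      by (intro nn_integral_PiM_component[where f = "\<lambda>x. ennreal (?E x)"] prob_space_person
          measurable_compose[OF excess_measurable measurable_ennreal]) simp
    then show ?thesis using excess by simp
  qed
  have "(\<integral>\<^sup>+X. ennreal (l2_dist d (clipped_mean d n m \<rho> c X) \<mu>) \<partial>?M)
      \<le> (\<integral>\<^sup>+X. ennreal (?S X / (real n * real m)) + ennreal (1 / real n) * (\<Sum>a<n. ennreal (?E (X a))) \<partial>?M)"
  proof (rule nn_integral_mono)
    fix X :: dataset
    have "ennreal (?S X / (real n * real m)) + ennreal (1 / real n) * (\<Sum>a<n. ennreal (?E (X a)))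
        = ennreal (?S X / (real n * real m) + (\<Sum>a<n. ?E (X a)) / real n)"
      by (subst sum_ennreal) (simp_all add: ennreal_mult[symmetric] sum_nonneg flip: ennreal_plus)
    then show "ennreal (l2_dist d (clipped_mean d n m \<rho> c X) \<mu>)
        \<le> ennreal (?S X / (real n * real m)) + ennreal (1 / real n) * (\<Sum>a<n. ennreal (?E (X a)))"
      using ennreal_leI[OF clipped_mean_error[OF n m \<rho>, of c X]] by (simp only:)
  qed
  also have "\<dots> = (\<integral>\<^sup>+X. ennreal (?S X / (real n * real m)) \<partial>?M)
      + ennreal (1 / real n) * (\<Sum>a<n. \<integral>\<^sup>+X. ennreal (?E (X a)) \<partial>?M)"
  proof -
    have sum: "(\<lambda>X. \<Sum>a<n. ennreal (?E (X a))) \<in> borel_measurable ?M"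
      by (intro borel_measurable_sum E_meas) simp
    have "(\<integral>\<^sup>+X. ennreal (1 / real n) * (\<Sum>a<n. ennreal (?E (X a))) \<partial>?M)
        = ennreal (1 / real n) * (\<integral>\<^sup>+X. (\<Sum>a<n. ennreal (?E (X a))) \<partial>?M)"
      by (rule nn_integral_cmult[OF sum])
    also have "(\<integral>\<^sup>+X. (\<Sum>a<n. ennreal (?E (X a))) \<partial>?M) = (\<Sum>a<n. \<integral>\<^sup>+X. ennreal (?E (X a)) \<partial>?M)"
      by (intro nn_integral_sum E_meas) simp
    finally have "(\<integral>\<^sup>+X. ennreal (1 / real n) * (\<Sum>a<n. ennreal (?E (X a))) \<partial>?M)
        = ennreal (1 / real n) * (\<Sum>a<n. \<integral>\<^sup>+X. ennreal (?E (X a)) \<partial>?M)" .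
    moreover have "(\<lambda>X. ennreal (1 / real n) * (\<Sum>a<n. ennreal (?E (X a)))) \<in> borel_measurable ?M"
      by (intro borel_measurable_times_ennreal borel_measurable_const sum)
    moreover have "(\<lambda>X. ennreal (?S X / (real n * real m))) \<in> borel_measurable ?M" by measurable
    ultimately show ?thesis by (simp only: nn_integral_add)
  qed
  also have "\<dots> \<le> ennreal (2 * \<tau>) + ennreal (1 / real n) * (\<Sum>a<n. ennreal e)"
    using E by (intro add_mono S mult_left_mono sum_mono) auto
  also have "\<dots> = ennreal (2 * \<tau> + e)"
    using n \<tau> by (subst sum_ennreal) (simp_all add: ennreal_mult[symmetric] flip: ennreal_plus)
  finally show ?thesis .
qed

text \<open>Sampling, noise and clipping each get a mean error of at most
  \<open>\<alpha> / 9\<close>; the two \<open>\<alpha> / 18\<close> are doubled by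
  \<open>nn_integral_le_of_square\<close>. The total \<open>\<alpha> / 3\<close> leaves a failure
  probability of \<open>1 / 3\<close> by Markov's inequality.\<close>

lemma clip_and_noise_accuracy:
  assumes n: "n > 0" and m: "m > 0" and \<rho>: "\<rho> \<ge> 0" and \<sigma>: "\<sigma> > 0" and \<alpha>: "\<alpha> > 0"
    and var: "2 * real d / (real n * real m) \<le> (\<alpha> / 18)\<^sup>2"
    and noise: "real d * \<sigma>\<^sup>2 \<le> (\<alpha> / 18)\<^sup>2"
    and excess: "(\<integral>\<^sup>+x. ennreal (max 0 (l2_dist d (person_average d m x) c - \<rho>)) \<partial>Pi\<^sub>M {..<m} (\<lambda>_. D))
      \<le> ennreal (\<alpha> / 9)"
  shows "measure (iid_dataset n m D \<bind> clip_and_noise d n m \<rho> \<sigma> c)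
    {y \<in> space (Rd d). l2_dist d y \<mu> \<le> \<alpha>} \<ge> 2 / 3"
proof -
  let ?M = "iid_dataset n m D" and ?A = "clip_and_noise d n m \<rho> \<sigma> c" and ?G = "gaussian_noise d \<sigma>"
  let ?cm = "clipped_mean d n m \<rho> c"
  interpret M: prob_space ?M by (rule prob_space_iid_dataset)
  interpret G: prob_space ?G unfolding gaussian_noise_eq by (rule prob_space_gauss_vec[OF \<sigma>])
  note K = clip_and_noise_kernel[OF \<sigma>, of n m \<rho> c]
  interpret B: prob_space "?M \<bind> ?A"
  proof (rule M.prob_space_bind[OF _ K])
    show "AE X in ?M. prob_space (?A X)"
      by (simp add: clip_and_noise_eq[OF \<sigma>] prob_space_gauss_vec[OF \<sigma>])
  qed
  have ne: "space ?M \<noteq> {}" by (rule M.not_empty)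
  have sets_B: "sets (?M \<bind> ?A) = sets (Rd d)"
    by (rule sets_bind[OF sets_kernel[OF K] ne])
  have space_B: "space (?M \<bind> ?A) = space (Rd d)" by (rule sets_eq_imp_space_eq[OF sets_B])
  have Rd_dist: "(\<lambda>y. l2_dist d y \<mu>) \<in> borel_measurable (Rd d)"
    unfolding l2_dist_def
    by (intro borel_measurable_l2_norm borel_measurable_diff measurable_Rd_component) auto
  then have dist_B [measurable]: "(\<lambda>y. l2_dist d y \<mu>) \<in> borel_measurable (?M \<bind> ?A)"
    by (simp cong: measurable_cong_sets add: sets_B)
  have comp: "(\<lambda>z. z i) \<in> borel_measurable ?G" if "i < d" for i
    using that unfolding gaussian_noise_eq by (intro measurable_Rd_component) auto
  have inner: "(\<integral>\<^sup>+y. ennreal (l2_dist d y \<mu>) \<partial>?A X) \<le> ennreal (l2_dist d (?cm X) \<mu>) + ennreal (\<alpha> / 9)" for X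
  proof -
    have shift: "(\<lambda>z. \<lambda>i\<in>{..<d}. ?cm X i + z i) \<in> ?G \<rightarrow>\<^sub>M Rd d"
      unfolding Rd_def by (intro measurable_restrict borel_measurable_add borel_measurable_const comp) simp
    have "(\<integral>\<^sup>+y. ennreal (l2_dist d y \<mu>) \<partial>?A X)
        = (\<integral>\<^sup>+z. ennreal (l2_dist d (\<lambda>i\<in>{..<d}. ?cm X i + z i) \<mu>) \<partial>?G)"
      unfolding clip_and_noise_def clipped_mean_def[symmetric] using Rd_dist
      by (intro nn_integral_distr shift) auto
    also have "\<dots> \<le> (\<integral>\<^sup>+z. ennreal (l2_dist d (?cm X) \<mu>) + ennreal (l2_norm d z) \<partial>?G)"
    proof (rule nn_integral_mono)
      fix z
      have "l2_dist d (\<lambda>i\<in>{..<d}. ?cm X i + z i) \<mu> = l2_norm d (\<lambda>i. (?cm X i - \<mu> i) + z i)"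
        unfolding l2_dist_def by (intro l2_norm_cong) simp
      also have "\<dots> \<le> l2_dist d (?cm X) \<mu> + l2_norm d z"
        unfolding l2_dist_def by (rule l2_norm_triangle)
      finally show "ennreal (l2_dist d (\<lambda>i\<in>{..<d}. ?cm X i + z i) \<mu>)
          \<le> ennreal (l2_dist d (?cm X) \<mu>) + ennreal (l2_norm d z)"
        by (simp add: l2_dist_def ennreal_leI flip: ennreal_plus)
    qed
    also have "\<dots> = ennreal (l2_dist d (?cm X) \<mu>) + (\<integral>\<^sup>+z. ennreal (l2_norm d z) \<partial>?G)"
    proof -
      have [measurable]: "l2_norm d \<in> borel_measurable ?G"
        using borel_measurable_l2_norm[OF comp] by simp
      show ?thesis by (subst nn_integral_add) (auto simp: G.emeasure_space_1)
    qed
    also have "\<dots> \<le> ennreal (l2_dist d (?cm X) \<mu>) + ennreal (2 * (\<alpha> / 18))"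
      using \<alpha> noise by (intro add_left_mono gaussian_noise_norm \<sigma>) auto
    finally show ?thesis by simp
  qed
  have "(\<integral>\<^sup>+y. ennreal (l2_dist d y \<mu>) \<partial>(?M \<bind> ?A)) = (\<integral>\<^sup>+X. \<integral>\<^sup>+y. ennreal (l2_dist d y \<mu>) \<partial>?A X \<partial>?M)"
    using Rd_dist by (intro nn_integral_bind[OF _ K]) auto
  also have "\<dots> \<le> (\<integral>\<^sup>+X. ennreal (l2_dist d (?cm X) \<mu>) + ennreal (\<alpha> / 9) \<partial>?M)"
    by (intro nn_integral_mono inner)
  also have "\<dots> = (\<integral>\<^sup>+X. ennreal (l2_dist d (?cm X) \<mu>) \<partial>?M) + ennreal (\<alpha> / 9)"
  proof -
    have [measurable]: "(\<lambda>X. l2_dist d (?cm X) \<mu>) \<in> borel_measurable ?M"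
      unfolding l2_dist_def
      by (intro borel_measurable_l2_norm borel_measurable_diff clipped_mean_measurable borel_measurable_const)
    show ?thesis by (subst nn_integral_add) (auto simp: M.emeasure_space_1)
  qed
  also have "\<dots> \<le> ennreal (2 * (\<alpha> / 18) + \<alpha> / 9) + ennreal (\<alpha> / 9)"
    using \<alpha> var excess by (intro add_right_mono expected_clipped_mean_error n m \<rho>) auto
  also have "\<dots> = ennreal (\<alpha> / 3)"
    using \<alpha> by (simp flip: ennreal_plus)
  finally have mean: "(\<integral>\<^sup>+y. ennreal (l2_dist d y \<mu>) \<partial>(?M \<bind> ?A)) \<le> ennreal (\<alpha> / 3)" .
  let ?good = "{y \<in> space (Rd d). l2_dist d y \<mu> \<le> \<alpha>}"
  let ?bad = "{y \<in> space (?M \<bind> ?A). 1 \<le> ennreal (1 / \<alpha>) * ennreal (l2_dist d y \<mu>)}"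
  have "emeasure (?M \<bind> ?A) ?bad \<le> ennreal (1 / \<alpha>) * (\<integral>\<^sup>+y. ennreal (l2_dist d y \<mu>) * indicator (space (?M \<bind> ?A)) y \<partial>(?M \<bind> ?A))"
    by (intro nn_integral_Markov_inequality) auto
  also have "\<dots> = ennreal (1 / \<alpha>) * (\<integral>\<^sup>+y. ennreal (l2_dist d y \<mu>) \<partial>(?M \<bind> ?A))"
    by (intro arg_cong2[where f = "(*)"] refl nn_integral_cong) simp
  also have "\<dots> \<le> ennreal (1 / \<alpha>) * ennreal (\<alpha> / 3)"
    by (intro mult_left_mono mean) simp
  also have "\<dots> = ennreal (1 / 3)"
    using \<alpha> by (simp add: ennreal_mult[symmetric])
  finally have bad: "B.prob ?bad \<le> 1 / 3"
    unfolding B.emeasure_eq_measure by (subst (asm) ennreal_le_iff) auto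
  have bad_sets: "?bad \<in> B.events" by measurable
  have "space (?M \<bind> ?A) - ?bad \<subseteq> ?good"
    using \<alpha> by (auto simp: space_B ennreal_mult[symmetric] l2_dist_def not_le field_simps)
  moreover have "?good \<in> B.events"
    unfolding space_B[symmetric] by measurable
  ultimately have "B.prob (space (?M \<bind> ?A) - ?bad) \<le> B.prob ?good"
    by (intro B.finite_measure_mono)
  then show ?thesis using B.prob_compl[OF bad_sets] bad by linarith
qed

end

section \<open>Sample complexity\<close>

text \<open>Here \<open>w\<close> fixes the truncation. The third bound says that the length scale
  in units of \<alpha> is at most linear in the rate, so its logarithm is a logarithm of the rate.
  The fourth prices the noise: the \<open>sqrt (d / m)\<close> part of the clipping radius produces
  the second summand of the rate and the truncation part the third.\<close>

lemma people_rate_bounds: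
  fixes k \<alpha> \<epsilon> \<delta> :: real
  assumes k: "k > 2" and d: "d \<ge> 1" and m: "m \<ge> 1" and \<alpha>: "\<alpha> > 0" and \<epsilon>: "\<epsilon> > 0" and \<delta>: "0 < \<delta>" "\<delta> < 1"
  defines "f \<equiv> people_rate k d m \<alpha> \<epsilon> \<delta>"
    and "w \<equiv> (18 * sqrt d / \<alpha>) powr (1 / (k - 1))"
  shows "0 < real d / (real m * \<alpha>\<^sup>2)" and "real d / (real m * \<alpha>\<^sup>2) \<le> f"
    and "sqrt (real d / real m) + 4 * sqrt d * w / real m \<le> 73 * \<alpha> * (exp 1 + f)"
    and "a \<ge> 0 \<Longrightarrow> b \<ge> 0 \<Longrightarrow>
      sqrt d * sqrt (ln (1 / \<delta>)) / (\<epsilon> * \<alpha>) * (a * sqrt (real d / real m) + b * (4 * sqrt d * w / real m))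
        \<le> (a + 72 * b) * f"
proof -
  define L where "L = ln (1 / \<delta>)"
  define u where "u = real d / (real m * \<alpha>\<^sup>2)"
  define f2 where "f2 = real d * sqrt L / (\<alpha> * sqrt m * \<epsilon>)"
  define f3 where "f3 = real d powr ((2 * k - 1) / (2 * k - 2)) * sqrt L / (\<alpha> powr (k / (k - 1)) * real m * \<epsilon>)"
  define s where "s = sqrt d / \<alpha>"
  have L: "L > 0" using \<delta> by (simp add: L_def)
  have f: "f = u + f2 + f3"
    by (simp add: f_def people_rate_def u_def f2_def f3_def L_def)
  have u: "u > 0" using d m \<alpha> by (simp add: u_def)
  have f2: "f2 \<ge> 0" and f3: "f3 \<ge> 0" using L \<alpha> \<epsilon> by (simp_all add: f2_def f3_def)
  show "0 < real d / (real m * \<alpha>\<^sup>2)" using u by (simp add: u_def)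
  show "real d / (real m * \<alpha>\<^sup>2) \<le> f" using f f2 f3 by (simp add: u_def)
  have s: "s > 0" using d \<alpha> by (simp add: s_def)
  have us: "u = s\<^sup>2 / real m" by (simp add: u_def s_def power_divide)
  \<comment> \<open>The exponent \<open>1 / (k - 1)\<close> is below 1, so 18 itself bounds the
    power of 18 uniformly in \<open>k\<close>. This is the source of 72 as \<open>4 * 18\<close>,
    and of 73 after adding \<open>sqrt (d / m)\<close>.\<close>
  have w: "w \<le> 18 * s powr (1 / (k - 1))"
  proof -
    have "w = 18 powr (1 / (k - 1)) * s powr (1 / (k - 1))"
      using s by (simp add: w_def s_def flip: powr_mult)
    also have "(18::real) powr (1 / (k - 1)) \<le> 18 powr 1"
      using k by (intro powr_mono) auto
    finally show ?thesis by (simp add: mult_right_mono)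
  qed
  have ws: "s * s powr (1 / (k - 1)) = s powr (k / (k - 1))"
  proof -
    have "1 + 1 / (k - 1) = k / (k - 1)" using k by (simp add: field_simps)
    then show ?thesis using s by (simp add: powr_mult_base)
  qed
  have e1: "exp 1 \<ge> (1::real)" by simp
  have E: "u \<le> exp 1 + f" "1 \<le> exp 1 + f" using f u f2 f3 e1 by linarith+
  have t1: "sqrt (real d / real m) \<le> \<alpha> * (exp 1 + f)"
  proof -
    have "sqrt u \<le> exp 1 + f"
    proof (rule real_le_lsqrt)
      show "u \<le> (exp 1 + f)\<^sup>2"
        using E(1) self_le_power[OF E(2), of 2] by linarith
    qed (use E in auto)
    moreover have "sqrt (real d / real m) = \<alpha> * sqrt u"
      using \<alpha> by (simp add: u_def real_sqrt_divide real_sqrt_mult)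
    ultimately show ?thesis using \<alpha> by simp
  qed
  \<comment> \<open>For \<open>s > 1\<close> the exponent \<open>k / (k - 1)\<close> is at most 2,
    which leads back to the first summand \<open>u\<close> of the rate; for \<open>s \<le> 1\<close>
    the summand \<open>exp 1\<close> is enough.\<close>
  have t2: "s powr (k / (k - 1)) / real m \<le> exp 1 + f"
  proof (cases "s \<le> 1")
    case True
    then have "s powr (k / (k - 1)) \<le> 1" using s k by (intro powr_le1) auto
    then have "s powr (k / (k - 1)) / real m \<le> 1" using m by (simp add: divide_le_eq)
    then show ?thesis using E by linarith
  next
    case False
    have "s powr (k / (k - 1)) \<le> s powr 2"
      using False k by (intro powr_mono) (auto simp: field_simps)
    then have "s powr (k / (k - 1)) / real m \<le> u"
      using s by (simp add: us powr_numeral divide_right_mono)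
    then show ?thesis using E by linarith
  qed
  have "4 * sqrt d * w / real m \<le> 4 * sqrt d * (18 * s powr (1 / (k - 1))) / real m"
    using w by (intro divide_right_mono mult_left_mono) auto
  also have "\<dots> = 72 * \<alpha> * (s powr (k / (k - 1)) / real m)"
    unfolding ws[symmetric] using \<alpha> by (simp add: s_def)
  also have "\<dots> \<le> 72 * \<alpha> * (exp 1 + f)"
    using t2 \<alpha> by (intro mult_left_mono) auto
  finally show "sqrt (real d / real m) + 4 * sqrt d * w / real m \<le> 73 * \<alpha> * (exp 1 + f)"
    using t1 by (simp add: algebra_simps)
  show "sqrt d * sqrt (ln (1 / \<delta>)) / (\<epsilon> * \<alpha>) * (a * sqrt (real d / real m) + b * (4 * sqrt d * w / real m))
        \<le> (a + 72 * b) * f" if ab: "a \<ge> 0" "b \<ge> 0"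
  proof -
    let ?c = "sqrt d * sqrt L / (\<epsilon> * \<alpha>)"
    have 1: "?c * sqrt (real d / real m) = f2"
    proof -
      have "sqrt d * sqrt L * sqrt d = sqrt L * real d" by simp
      then show ?thesis by (simp add: f2_def real_sqrt_divide mult_ac)
    qed
    have 2: "?c * (4 * sqrt d * w / real m) \<le> 72 * f3"
    proof -
      have c: "?c * (4 * sqrt d / real m) \<ge> 0" using L \<epsilon> \<alpha> by simp
      have "?c * (4 * sqrt d * w / real m) = ?c * (4 * sqrt d / real m) * w" by simp
      also have "\<dots> \<le> ?c * (4 * sqrt d / real m) * (18 * s powr (1 / (k - 1)))"
        by (rule mult_left_mono[OF w c])
      also have "\<dots> = 72 * f3"
      proof -
        \<comment> \<open>Origin of the exponent of \<open>d\<close> in the rate: the noise norm and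
          the truncation radius each contribute \<open>sqrt d\<close>, and \<open>w\<close>
          contributes a further power \<open>1 / (k - 1)\<close> of \<open>sqrt d\<close>.\<close>
        have "(2 * k - 1) / (2 * k - 2) = 1 + 1 / 2 * (1 / (k - 1))"
          using k by (simp add: field_simps)
        then have "real d powr ((2 * k - 1) / (2 * k - 2)) = real d * sqrt d powr (1 / (k - 1))"
          using d by (simp add: powr_add powr_powr flip: powr_half_sqrt)
        moreover have "\<alpha> powr (k / (k - 1)) = \<alpha> * \<alpha> powr (1 / (k - 1))"
        proof -
          have "k / (k - 1) = 1 + 1 / (k - 1)" using k by (simp add: field_simps)
          then show ?thesis using \<alpha> by (simp add: powr_mult_base)
        qed
        moreover have "sqrt d * (z * (sqrt d * y)) = real d * (y * z)" for y z
        proof -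
          have "sqrt d * (z * (sqrt d * y)) = sqrt d * sqrt d * (y * z)" by (simp only: mult_ac)
          then show ?thesis by simp
        qed
        ultimately show ?thesis
          using \<alpha> by (simp add: f3_def s_def powr_divide mult_ac)
      qed
      finally show ?thesis .
    qed
    have "?c * (a * sqrt (real d / real m) + b * (4 * sqrt d * w / real m))
        = a * (?c * sqrt (real d / real m)) + b * (?c * (4 * sqrt d * w / real m))"
      by (simp only: distrib_left mult.left_commute)
    also have "\<dots> \<le> a * f2 + b * (72 * f3)"
      unfolding 1 using 2 ab by (intro add_left_mono mult_left_mono)
    also have "\<dots> \<le> (a + 72 * b) * f"
    proof -
      have "a * f2 \<le> a * f" "b * (72 * f3) \<le> b * (72 * f)"
        using f f2 f3 u ab by (auto intro!: mult_left_mono)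
      then show ?thesis by (simp add: algebra_simps)
    qed
    finally show ?thesis by (simp add: L_def)
  qed
qed

theorem theorem4p20:
  fixes k C\<^sub>0 K :: real
  assumes "k > 2" and "C\<^sub>0 > 0" and "K > 0"
  shows "\<exists>C>0. \<exists>p::nat. \<forall>(d::nat) (m::nat) (n::nat) (\<alpha>::real) (\<epsilon>::real) (\<delta>::real).
    d \<ge> 1 \<and> m \<ge> 1 \<and> \<alpha> > 0 \<and> \<epsilon> > 0 \<and> 0 < \<delta> \<and> \<delta> < 1 \<and> \<epsilon> \<le> K * ln (1 / \<delta>) \<and>
    real n \<ge> soft_O C p (people_rate k d m \<alpha> \<epsilon> \<delta>) \<longrightarrow>
    (\<exists>\<rho>>0. \<exists>\<sigma>>0.
      (\<forall>\<mu>\<^sub>c \<in> space (Rd d). person_level_DP d n m \<epsilon> \<delta> (clip_and_noise d n m \<rho> \<sigma> \<mu>\<^sub>c)) \<and>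
      (\<forall>D \<mu> \<mu>\<^sub>c.
        prob_space D \<and> sets D = sets (Rd d) \<and> has_mean d D \<mu> \<and> moment_bounded d k D \<mu> \<and>
        \<mu>\<^sub>c \<in> space (Rd d) \<and> l2_dist d \<mu>\<^sub>c \<mu> \<le> C\<^sub>0 * sqrt (real d / real m) \<longrightarrow>
        measure (iid_dataset n m D \<bind> clip_and_noise d n m \<rho> \<sigma> \<mu>\<^sub>c)
          {y \<in> space (Rd d). l2_dist d y \<mu> \<le> \<alpha>} \<ge> 2 / 3))"
proof -
  \<comment> \<open>Since \<open>1314 = 18 * 73\<close>, this \<open>C3\<close> turns
    \<open>g * exp (10 - T)\<close> into at most \<open>\<alpha> / 18\<close>. In \<open>C4\<close>
    the 73 collects \<open>T + 72 * T\<close> from the noise bound. In \<open>C\<close> the 648 is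
    \<open>2 * 18\<^sup>2\<close> from the sampling variance, and 36 is \<open>2 * 18\<close> from
    the sensitivity \<open>2 * \<rho> / n\<close> and the noise budget
    \<open>\<alpha> / 18\<close>.\<close>
  define C3 where "C3 = 10 + ln (1314 :: real)"
  define C4 where "C4 = C\<^sub>0 + 73 * (1 + C3)"
  define C where "C = 648 + 36 * sqrt (K + 2) * C4"
  have C3: "C3 > 0" by (simp add: C3_def add_pos_nonneg)
  have C4: "C4 > 0" using assms C3 by (simp add: C4_def)
  have C: "C \<ge> 648" "C \<ge> 36 * sqrt (K + 2) * C4" using C4 assms by (simp_all add: C_def)
  have C0: "C > 0" using C by simp
  show ?thesis
  \<comment> \<open>The exponent of the polylogarithm is 1, since \<open>T\<close> is the sole
    logarithmic loss and enters \<rho> linearly.\<close>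
  proof (rule exI[of _ C], rule conjI[OF C0], rule exI[of _ 1], intro allI impI, elim conjE)
    fix d m n :: nat and \<alpha> \<epsilon> \<delta> :: real
    assume d: "d \<ge> 1" and m: "m \<ge> 1" and \<alpha>: "\<alpha> > 0" and \<epsilon>: "\<epsilon> > 0" and \<delta>: "0 < \<delta>" "\<delta> < 1"
      and \<epsilon>K: "\<epsilon> \<le> K * ln (1 / \<delta>)" and n_ge: "real n \<ge> soft_O C 1 (people_rate k d m \<alpha> \<epsilon> \<delta>)"
    define f where "f = people_rate k d m \<alpha> \<epsilon> \<delta>"
    \<comment> \<open>The truncation radius is \<open>m * g / 2\<close>. The summand \<open>h\<close> of \<open>g\<close> is just large enough for the removed part of a
      sample to be \<open>O(\<alpha>)\<close> in mean, and \<open>T\<close> just large enough for \<open>g * exp (- T)\<close> to be \<open>O(\<alpha>)\<close>; only \<open>T\<close> costs a logarithm.\<close>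
    define w where "w = (18 * sqrt d / \<alpha>) powr (1 / (k - 1))"
    define T where "T = ln (exp 1 + f) + C3"
    define h where "h = 4 * sqrt d * w / real m"
    define g where "g = sqrt (real d / real m) + h"
    define \<rho> where "\<rho> = C\<^sub>0 * sqrt (real d / real m) + g * T"
    define L where "L = ln (1 / \<delta>)"
    define \<sigma> where "\<sigma> = sqrt (K + 2) * (2 * \<rho> / real n) * sqrt L / \<epsilon>"
    note rate = people_rate_bounds[OF assms(1) d m \<alpha> \<epsilon> \<delta>, folded f_def w_def]
    have f: "f > 0" using rate(1,2) by linarith
    have L: "L > 0" using \<delta> by (simp add: L_def)
    have l: "ln (exp 1 + f) \<ge> 1" using f by (subst ln_ge_iff) (auto simp: add_pos_pos)
    have n: "real n \<ge> C * f * ln (exp 1 + f)" using n_ge by (simp add: soft_O_def f_def)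
    have n0: "real n > 0"
      using n f l C by (intro less_le_trans[OF _ n] mult_pos_pos) auto
    have T: "T \<le> (1 + C3) * ln (exp 1 + f)" "T > 0"
      using l C3 mult_left_mono[of 1 "ln (exp 1 + f)" C3] by (simp_all add: T_def algebra_simps)
    have w: "w > 0" using d \<alpha> by (simp add: w_def)
    have h: "h > 0" using w d m by (simp add: h_def)
    have g: "g \<ge> sqrt (real d / real m)" "g > 0" using h by (simp_all add: g_def add_nonneg_pos)
    have \<rho>: "\<rho> > 0" using assms g T by (simp add: \<rho>_def add_nonneg_pos)
    have \<sigma>: "\<sigma> > 0" using \<rho> n0 L \<epsilon> assms by (simp add: \<sigma>_def)
    have var: "2 * real d / (real n * real m) \<le> (\<alpha> / 18)\<^sup>2"
    proof -
      have "648 * (real d / (real m * \<alpha>\<^sup>2)) \<le> C * f"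
        using C rate(1,2) f by (intro mult_mono) auto
      also have "\<dots> \<le> C * f * ln (exp 1 + f)"
        using l C f by simp
      also note n
      finally show ?thesis
        using m \<alpha> n0 by (simp add: field_simps power2_eq_square)
    qed
    have noise: "real d * \<sigma>\<^sup>2 \<le> (\<alpha> / 18)\<^sup>2"
    proof -
      \<comment> \<open>Regrouped by the two length scales, so that the fourth rate bound applies
        with \<open>a = C\<^sub>0 + T\<close> and \<open>b = T\<close>.\<close>
      have \<rho>_eq: "\<rho> = (C\<^sub>0 + T) * sqrt (real d / real m) + T * h"
        by (simp add: \<rho>_def g_def algebra_simps)
      have "sqrt d * sqrt L / (\<epsilon> * \<alpha>) * \<rho> \<le> (C\<^sub>0 + T + 72 * T) * f"
        unfolding \<rho>_eq h_def L_def using T assms by (intro rate(4)) auto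
      also have "\<dots> \<le> C4 * ln (exp 1 + f) * f"
      proof (rule mult_right_mono)
        have "C\<^sub>0 \<le> C\<^sub>0 * ln (exp 1 + f)" using l assms by simp
        then show "C\<^sub>0 + T + 72 * T \<le> C4 * ln (exp 1 + f)"
          using T by (simp add: C4_def algebra_simps)
      qed (use f in simp)
      finally have "36 * sqrt (K + 2) * (sqrt d * sqrt L / (\<epsilon> * \<alpha>) * \<rho>)
          \<le> 36 * sqrt (K + 2) * (C4 * ln (exp 1 + f) * f)"
        using assms by (intro mult_left_mono) auto
      also have "\<dots> = 36 * sqrt (K + 2) * C4 * (f * ln (exp 1 + f))" by simp
      also have "\<dots> \<le> C * (f * ln (exp 1 + f))"
        using C f l by (intro mult_right_mono) auto
      also have "\<dots> \<le> real n" using n by (simp add: mult.assoc)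
      finally have "sqrt d * \<sigma> \<le> \<alpha> / 18"
        using \<epsilon> \<alpha> n0 by (simp add: \<sigma>_def field_simps)
      then have "(sqrt d * \<sigma>)\<^sup>2 \<le> (\<alpha> / 18)\<^sup>2"
        using \<sigma> by (intro power_mono) auto
      then show ?thesis by (simp add: power_mult_distrib)
    qed
    have excess: "sqrt d * (real m * g / (4 * sqrt d)) powr (1 - k) + g * exp (10 - T) \<le> \<alpha> / 9"
    proof -
      \<comment> \<open>The summand \<open>h\<close> of \<open>g\<close> alone already reaches
        \<open>w\<close> after rescaling. The exponent in \<open>w\<close> is inverse to
        \<open>k - 1\<close>, so the tail term collapses to \<open>\<alpha> / 18\<close>.\<close>
      have "w \<le> real m * g / (4 * sqrt d)"
        using d m by (simp add: g_def h_def field_simps)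
      then have "(real m * g / (4 * sqrt d)) powr (1 - k) \<le> w powr (1 - k)"
        using w assms by (intro powr_mono2') auto
      also have "w powr (1 - k) = \<alpha> / (18 * sqrt d)"
      proof -
        have "1 / (k - 1) * (1 - k) = - 1" using assms by (simp add: field_simps)
        then show ?thesis
          using d \<alpha> by (simp add: w_def powr_powr powr_minus_divide)
      qed
      finally have "sqrt d * (real m * g / (4 * sqrt d)) powr (1 - k) \<le> sqrt d * (\<alpha> / (18 * sqrt d))"
        by (rule mult_left_mono) simp
      also have "\<dots> = \<alpha> / 18" using d by simp
      finally have 1: "sqrt d * (real m * g / (4 * sqrt d)) powr (1 - k) \<le> \<alpha> / 18" .
      have E: "exp 1 + f > 0" using f by (simp add: add_pos_pos)
      have T_eq: "exp (10 - T) = 1 / (1314 * (exp 1 + f))"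
        using E by (simp add: T_def C3_def exp_diff exp_add exp_minus inverse_eq_divide)
      have "g \<le> 73 * \<alpha> * (exp 1 + f)"
        using rate(3) by (simp add: g_def h_def)
      then have "g * exp (10 - T) \<le> 73 * \<alpha> * (exp 1 + f) * exp (10 - T)"
        by (rule mult_right_mono) simp
      also have "\<dots> = \<alpha> / 18"
      proof -
        have "73 * \<alpha> * x * (1 / (1314 * x)) = \<alpha> / 18" if "x > 0" for x :: real
          using that by simp
        from this[OF E] show ?thesis unfolding T_eq .
      qed
      finally have "g * exp (10 - T) \<le> \<alpha> / 18" .
      with 1 show ?thesis by simp
    qed
    show "\<exists>\<rho>>0. \<exists>\<sigma>>0.
      (\<forall>\<mu>\<^sub>c \<in> space (Rd d). person_level_DP d n m \<epsilon> \<delta> (clip_and_noise d n m \<rho> \<sigma> \<mu>\<^sub>c)) \<and>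
      (\<forall>D \<mu> \<mu>\<^sub>c.
        prob_space D \<and> sets D = sets (Rd d) \<and> has_mean d D \<mu> \<and> moment_bounded d k D \<mu> \<and>
        \<mu>\<^sub>c \<in> space (Rd d) \<and> l2_dist d \<mu>\<^sub>c \<mu> \<le> C\<^sub>0 * sqrt (real d / real m) \<longrightarrow>
        measure (iid_dataset n m D \<bind> clip_and_noise d n m \<rho> \<sigma> \<mu>\<^sub>c)
          {y \<in> space (Rd d). l2_dist d y \<mu> \<le> \<alpha>} \<ge> 2 / 3)"
    proof (rule exI[of _ \<rho>], rule conjI[OF \<rho>], rule exI[of _ \<sigma>], rule conjI[OF \<sigma>],
        intro conjI ballI allI impI; (elim conjE)?)
      show "person_level_DP d n m \<epsilon> \<delta> (clip_and_noise d n m \<rho> \<sigma> \<mu>\<^sub>c)" for \<mu>\<^sub>c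
        using n0 by (intro clip_and_noise_DP[OF _ \<rho> \<epsilon> \<delta> \<epsilon>K assms(3)]) (auto simp: \<sigma>_def L_def)
    next
      fix D \<mu> \<mu>\<^sub>c
      assume D: "prob_space D" "sets D = sets (Rd d)" "has_mean d D \<mu>" "moment_bounded d k D \<mu>"
        and c: "l2_dist d \<mu>\<^sub>c \<mu> \<le> C\<^sub>0 * sqrt (real d / real m)"
      interpret bounded_moment D d \<mu> k
        using D assms by (intro bounded_moment.intro bounded_moment_axioms.intro)
      show "measure (iid_dataset n m D \<bind> clip_and_noise d n m \<rho> \<sigma> \<mu>\<^sub>c)
          {y \<in> space (Rd d). l2_dist d y \<mu> \<le> \<alpha>} \<ge> 2 / 3"
      proof (rule clip_and_noise_accuracy)
        show "(\<integral>\<^sup>+x. ennreal (max 0 (l2_dist d (person_average d m x) \<mu>\<^sub>c - \<rho>)) \<partial>Pi\<^sub>M {..<m} (\<lambda>_. D))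
            \<le> ennreal (\<alpha> / 9)"
          using person_excess[OF _ _ g(1) c \<rho>_def] ennreal_leI[OF excess] d m by (auto intro: order_trans)
      qed (use n0 m \<rho> \<sigma> \<alpha> var noise in auto)
    qed
  qed
qed

end
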